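(* Let $\mathfrak{A}$ be a $C^*$-algebra, let $H$ and $K$ be Hilbert $\mathfrak{A}$-modules, and let $M$ and $N$ be orthogonally complemented closed submodules of $H$ and $K$, respectively. Suppose that $T\in\mathcal{L}(H,K)$ is $(M,N)$-weakly complementable. Then $$\mathcal{R}(T)\cap N\subseteq\mathcal{R}\big(T_{/(M,N)}\big)\subseteq\overline{\mathcal{R}(T)}\cap N.$$
   Context: For Hilbert $\mathfrak{A}$-modules $H,K$, $\mathcal{L}(H,K)$ denotes the set of adjointable operators from $H$ to $K$. $\mathcal{R}(\cdot)$ denotes range, the bar norm closure, $|T|=(T^*T)^{1/2}$. A closed submodule $M\subseteq H$ is orthogonally complemented if $H=M+M^\perp$; $P_M$ is then the projection onto $M$. $U_{P_M}:H\to M\oplus M^\perp$ is the unitary $h\mapsto (P_Mh,(I_H-P_M)h)^T$, and $U_{P_N}:K\to N\oplus N^\perp$ is defined likewise. Reduced solution: for $A\in\mathcal{L}(H_1,K_1)$, $C\in\mathcal{L}(E_1,K_1)$, an operator $D\in\mathcal{L}(E_1,H_1)$ is the reduced solution of $AX=C$, $X\in\mathcal{L}(E_1,H_1)$, if $AD=C$ and $\mathcal{R}(D)\subseteq\overline{\mathcal{R}(A^* )}$ (unique if it exists). For every $R\in\mathcal{L}(H_1,K_1)$ the system $|R^*|^{1/2}X=R$, $X\in\mathcal{L}(H_1,K_1)$, has a reduced solution, denoted $V_R$. Blocks of $T\in\mathcal{L}(H,K)$: with $P_{M^\perp}=I_H-P_M$, $P_{N^\perp}=I_K-P_N$, $T_{11}=P_NTP_M|_M\in\mathcal{L}(M,N)$,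 $T_{12}=P_NTP_{M^\perp}|_{M^\perp}\in\mathcal{L}(M^\perp,N)$, $T_{21}=P_{N^\perp}TP_M|_M\in\mathcal{L}(M,N^\perp)$, $T_{22}=P_{N^\perp}TP_{M^\perp}|_{M^\perp}\in\mathcal{L}(M^\perp,N^\perp)$. $T$ is $(M,N)$-weakly complementable if all four systems $V_{T_{22}}Y_1=T_{21}$ ($Y_1\in\mathcal{L}(M,M^\perp)$), $|T_{22}|^{1/2}Y_2=T_{12}^*$ ($Y_2\in\mathcal{L}(N,M^\perp)$), $|T_{22}^*|^{1/2}Z_1=T_{21}$ ($Z_1\in\mathcal{L}(M,N^\perp)$), $V_{T_{22}}^*Z_2=T_{12}^*$ ($Z_2\in\mathcal{L}(N,N^\perp)$) have reduced solutions, denoted $E,F,\widetilde{E},\widetilde{F}$ respectively. In that case the bilateral shorted operator of $T$ with respect to $(M,N)$ is $$T_{/(M,N)}=U_{P_N}^*\begin{pmatrix}T_{11}-\frac12\big[F^*E+\widetilde{F}^*\widetilde{E}\big]&0\\0&0\end{pmatrix}U_{P_M}\in\mathcal{L}(H,K).$$ *)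

theory Defs
  imports "HOL-Analysis.Analysis"
begin

section \<open>C*-algebras\<close>

class complex_vector = real_vector +
  fixes scaleC :: "complex \<Rightarrow> 'a \<Rightarrow> 'a"  (infixr \<open>*\<^sub>C\<close> 75)
  assumes scaleC_add_right: "c *\<^sub>C (x + y) = c *\<^sub>C x + c *\<^sub>C y"
    and scaleC_add_left: "(c + d) *\<^sub>C x = c *\<^sub>C x + d *\<^sub>C x"
    and scaleC_scaleC: "c *\<^sub>C d *\<^sub>C x = (c * d) *\<^sub>C x"
    and scaleC_of_real: "complex_of_real r *\<^sub>C x = r *\<^sub>R x"

class complex_normed_vector = complex_vector + real_normed_vector +
  assumes norm_scaleC: "norm (c *\<^sub>C x) = cmod c * norm x"

text \<open>No unit is required.\<close>

class cstar_algebra = complex_normed_vector + real_normed_algebra + banach +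
  fixes star :: "'a \<Rightarrow> 'a"
  assumes mult_scaleC_left: "(c *\<^sub>C a) * b = c *\<^sub>C (a * b)"
    and mult_scaleC_right: "a * (c *\<^sub>C b) = c *\<^sub>C (a * b)"
    and star_star: "star (star a) = a"
    and star_add: "star (a + b) = star a + star b"
    and star_scaleC: "star (c *\<^sub>C a) = cnj c *\<^sub>C star a"
    and star_mult: "star (a * b) = star b * star a"
    and cstar_identity: "norm (star a * a) = (norm a)\<^sup>2"

definition cstar_pos :: "'a::cstar_algebra \<Rightarrow> bool" where
  "cstar_pos a \<longleftrightarrow> (\<exists>b. a = star b * b)"


section \<open>Hilbert modules\<close>

text \<open>
  A module lives on a subset of a normed space, so that a closed submodule is obtained by shrinking
  the carrier. Modules are right modules and inner products are linear in the second argument. The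
  norm of the ambient type is the one induced by the inner product on the carrier, so that
  topological notions such as \<^const>\<open>closure\<close> are those of the library.
\<close>

record ('x, 'a) hmodule =
  carrier :: "'x set"
  hinner :: "'x \<Rightarrow> 'x \<Rightarrow> 'a"
  act :: "'x \<Rightarrow> 'a \<Rightarrow> 'x"

locale hilbert_module =
  fixes H :: "('x::complex_normed_vector, 'a::cstar_algebra) hmodule"
  assumes zero_closed: "0 \<in> carrier H"
    and add_closed: "\<lbrakk>x \<in> carrier H; y \<in> carrier H\<rbrakk> \<Longrightarrow> x + y \<in> carrier H"
    and scaleC_closed: "x \<in> carrier H \<Longrightarrow> c *\<^sub>C x \<in> carrier H"
    and act_closed: "x \<in> carrier H \<Longrightarrow> act H x a \<in> carrier H"
    and act_add_left:
      "\<lbrakk>x \<in> carrier H; y \<in> carrier H\<rbrakk> \<Longrightarrow> act H (x + y) a = act H x a + act H y a"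
    and act_add_right: "x \<in> carrier H \<Longrightarrow> act H x (a + b) = act H x a + act H x b"
    and act_mult: "x \<in> carrier H \<Longrightarrow> act H x (a * b) = act H (act H x a) b"
    and act_scaleC_left: "x \<in> carrier H \<Longrightarrow> act H (c *\<^sub>C x) a = c *\<^sub>C act H x a"
    and act_scaleC_right: "x \<in> carrier H \<Longrightarrow> act H x (c *\<^sub>C a) = c *\<^sub>C act H x a"
    and hinner_add_right:
      "\<lbrakk>x \<in> carrier H; y \<in> carrier H; z \<in> carrier H\<rbrakk>
        \<Longrightarrow> hinner H x (y + z) = hinner H x y + hinner H x z"
    and hinner_scaleC_right:
      "\<lbrakk>x \<in> carrier H; y \<in> carrier H\<rbrakk> \<Longrightarrow> hinner H x (c *\<^sub>C y) = c *\<^sub>C hinner H x y"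
    and hinner_act_right:
      "\<lbrakk>x \<in> carrier H; y \<in> carrier H\<rbrakk> \<Longrightarrow> hinner H x (act H y a) = hinner H x y * a"
    and star_hinner:
      "\<lbrakk>x \<in> carrier H; y \<in> carrier H\<rbrakk> \<Longrightarrow> star (hinner H x y) = hinner H y x"
    and hinner_pos: "x \<in> carrier H \<Longrightarrow> cstar_pos (hinner H x x)"
    and hinner_definite: "\<lbrakk>x \<in> carrier H; hinner H x x = 0\<rbrakk> \<Longrightarrow> x = 0"
    and norm_eq: "x \<in> carrier H \<Longrightarrow> norm x = sqrt (norm (hinner H x x))"
    and complete_carrier: "complete (carrier H)"

definition closed_submodule ::
  "('x::complex_normed_vector, 'a::cstar_algebra) hmodule \<Rightarrow> 'x set \<Rightarrow> bool" where
  "closed_submodule H M \<longleftrightarrow>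
     M \<subseteq> carrier H \<and> closed M \<and> 0 \<in> M \<and> (\<forall>x\<in>M. \<forall>y\<in>M. x + y \<in> M) \<and>
     (\<forall>c. \<forall>x\<in>M. c *\<^sub>C x \<in> M) \<and> (\<forall>a. \<forall>x\<in>M. act H x a \<in> M)"

definition sub :: "('x, 'a) hmodule \<Rightarrow> 'x set \<Rightarrow> ('x, 'a) hmodule" where
  "sub H M = H\<lparr>carrier := M\<rparr>"

definition ortho :: "('x, 'a::zero) hmodule \<Rightarrow> 'x set \<Rightarrow> 'x set" where
  "ortho H M = {x \<in> carrier H. \<forall>y\<in>M. hinner H y x = 0}"

definition orth_complemented ::
  "('x::complex_normed_vector, 'a::cstar_algebra) hmodule \<Rightarrow> 'x set \<Rightarrow> bool" where
  "orth_complemented H M \<longleftrightarrow>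
     closed_submodule H M \<and> carrier H = {x + y | x y. x \<in> M \<and> y \<in> ortho H M}"

text \<open>
  The external direct sum. Only its carrier and inner product are used below; the norm of the
  product type is equivalent, but not equal, to the one given by this inner product.
\<close>

definition hsum ::
  "('x, 'a::plus) hmodule \<Rightarrow> ('y, 'a) hmodule \<Rightarrow> ('x \<times> 'y, 'a) hmodule" where
  "hsum H K =
     \<lparr>carrier = carrier H \<times> carrier K,
      hinner = (\<lambda>u v. hinner H (fst u) (fst v) + hinner K (snd u) (snd v)),
      act = (\<lambda>u a. (act H (fst u) a, act K (snd u) a))\<rparr>"


section \<open>Adjointable operators\<close>

text \<open>
  An operator with domain \<open>H\<close> is a function that is \<^const>\<open>undefined\<close> outside \<open>carrier H\<close>, so equality of
  operators is equality of functions. Linearity and boundedness follow from adjointability.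
\<close>

definition is_adjoint ::
  "('x, 'a) hmodule \<Rightarrow> ('y, 'a) hmodule \<Rightarrow> ('x \<Rightarrow> 'y) \<Rightarrow> ('y \<Rightarrow> 'x) \<Rightarrow> bool" where
  "is_adjoint H K T S \<longleftrightarrow>
     T \<in> carrier H \<rightarrow>\<^sub>E carrier K \<and> S \<in> carrier K \<rightarrow>\<^sub>E carrier H \<and>
     (\<forall>x\<in>carrier H. \<forall>y\<in>carrier K. hinner K (T x) y = hinner H x (S y))"

definition adjointable :: "('x, 'a) hmodule \<Rightarrow> ('y, 'a) hmodule \<Rightarrow> ('x \<Rightarrow> 'y) set" where
  "adjointable H K = {T. \<exists>S. is_adjoint H K T S}"

definition adj :: "('x, 'a) hmodule \<Rightarrow> ('y, 'a) hmodule \<Rightarrow> ('x \<Rightarrow> 'y) \<Rightarrow> 'y \<Rightarrow> 'x" where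
  "adj H K T = (THE S. is_adjoint H K T S)"

definition pos_op :: "('x, 'a) hmodule \<Rightarrow> ('x \<Rightarrow> 'x) \<Rightarrow> bool" where
  "pos_op H T \<longleftrightarrow> (\<exists>S\<in>adjointable H H. T = compose (carrier H) (adj H H S) S)"

definition sqrt_op :: "('x, 'a) hmodule \<Rightarrow> ('x \<Rightarrow> 'x) \<Rightarrow> 'x \<Rightarrow> 'x" where
  "sqrt_op H T = (THE S. pos_op H S \<and> compose (carrier H) S S = T)"

definition abs_op :: "('x, 'a) hmodule \<Rightarrow> ('y, 'a) hmodule \<Rightarrow> ('x \<Rightarrow> 'y) \<Rightarrow> 'x \<Rightarrow> 'x" where
  "abs_op H K T = sqrt_op H (compose (carrier H) (adj H K T) T)"

definition proj :: "('x::ab_group_add, 'a::zero) hmodule \<Rightarrow> 'x set \<Rightarrow> 'x \<Rightarrow> 'x" where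
  "proj H M = (\<lambda>h\<in>carrier H. THE p. p \<in> M \<and> h - p \<in> ortho H M)"

definition coproj :: "('x::ab_group_add, 'a::zero) hmodule \<Rightarrow> 'x set \<Rightarrow> 'x \<Rightarrow> 'x" where
  "coproj H M = (\<lambda>h\<in>carrier H. h - proj H M h)"


section \<open>Reduced solutions\<close>

text \<open>The system is \<open>A X = C\<close> with \<open>A\<close> from \<open>H\<close> to \<open>K\<close>, \<open>C\<close> from \<open>E\<close> to \<open>K\<close> and \<open>X\<close> from \<open>E\<close> to \<open>H\<close>.\<close>

definition reduced_solution ::
  "('e, 'a) hmodule \<Rightarrow> ('x::topological_space, 'a) hmodule \<Rightarrow> ('y, 'a) hmodule \<Rightarrow>
   ('x \<Rightarrow> 'y) \<Rightarrow> ('e \<Rightarrow> 'y) \<Rightarrow> ('e \<Rightarrow> 'x) \<Rightarrow> bool" where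
  "reduced_solution E H K A C D \<longleftrightarrow>
     D \<in> adjointable E H \<and> compose (carrier E) A D = C \<and>
     D ` carrier E \<subseteq> closure (adj H K A ` carrier K)"

definition has_reduced_solution ::
  "('e, 'a) hmodule \<Rightarrow> ('x::topological_space, 'a) hmodule \<Rightarrow> ('y, 'a) hmodule \<Rightarrow>
   ('x \<Rightarrow> 'y) \<Rightarrow> ('e \<Rightarrow> 'y) \<Rightarrow> bool" where
  "has_reduced_solution E H K A C \<longleftrightarrow> (\<exists>D. reduced_solution E H K A C D)"

definition the_reduced_solution ::
  "('e, 'a) hmodule \<Rightarrow> ('x::topological_space, 'a) hmodule \<Rightarrow> ('y, 'a) hmodule \<Rightarrow>
   ('x \<Rightarrow> 'y) \<Rightarrow> ('e \<Rightarrow> 'y) \<Rightarrow> 'e \<Rightarrow> 'x" where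
  "the_reduced_solution E H K A C = (THE D. reduced_solution E H K A C D)"

text \<open>\<open>sqrt_abs H K R\<close> is \<open>|R|\<close> to the power \<open>1/2\<close>, and \<open>V_op H K R\<close> is \<open>V\<^sub>R\<close>.\<close>

definition sqrt_abs :: "('x, 'a) hmodule \<Rightarrow> ('y, 'a) hmodule \<Rightarrow> ('x \<Rightarrow> 'y) \<Rightarrow> 'x \<Rightarrow> 'x" where
  "sqrt_abs H K R = sqrt_op H (abs_op H K R)"

definition V_op ::
  "('x, 'a) hmodule \<Rightarrow> ('y::topological_space, 'a) hmodule \<Rightarrow> ('x \<Rightarrow> 'y) \<Rightarrow> 'x \<Rightarrow> 'y" where
  "V_op H K R = the_reduced_solution H K K (sqrt_abs K H (adj H K R)) R"


section \<open>Weak complementability and the bilateral shorted operator\<close>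

context
  fixes H :: "('x::complex_normed_vector, 'a::cstar_algebra) hmodule"
    and K :: "('y::complex_normed_vector, 'a) hmodule"
    and M :: "'x set" and N :: "'y set" and T :: "'x \<Rightarrow> 'y"
begin

definition block11 :: "'x \<Rightarrow> 'y" where
  "block11 = (\<lambda>x\<in>M. proj K N (T (proj H M x)))"

definition block12 :: "'x \<Rightarrow> 'y" where
  "block12 = (\<lambda>x\<in>ortho H M. proj K N (T (coproj H M x)))"

definition block21 :: "'x \<Rightarrow> 'y" where
  "block21 = (\<lambda>x\<in>M. coproj K N (T (proj H M x)))"

definition block22 :: "'x \<Rightarrow> 'y" where
  "block22 = (\<lambda>x\<in>ortho H M. coproj K N (T (coproj H M x)))"

definition weakly_complementable :: bool where
  "weakly_complementable \<longleftrightarrow>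
    (let HM = sub H M; HM' = sub H (ortho H M);
         KN = sub K N; KN' = sub K (ortho K N);
         T12' = adj HM' KN block12; T22' = adj HM' KN' block22;
         V = V_op HM' KN' block22
     in has_reduced_solution HM HM' KN' V block21 \<and>
        has_reduced_solution KN HM' HM' (sqrt_abs HM' KN' block22) T12' \<and>
        has_reduced_solution HM KN' KN' (sqrt_abs KN' HM' T22') block21 \<and>
        has_reduced_solution KN KN' HM' (adj HM' KN' V) T12')"

definition shorted_corner :: "'x \<Rightarrow> 'y" where
  "shorted_corner =
    (let HM = sub H M; HM' = sub H (ortho H M);
         KN = sub K N; KN' = sub K (ortho K N);
         T12' = adj HM' KN block12; T22' = adj HM' KN' block22;
         V = V_op HM' KN' block22;
         E = the_reduced_solution HM HM' KN' V block21;
         F = the_reduced_solution KN HM' HM' (sqrt_abs HM' KN' block22) T12';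
         E2 = the_reduced_solution HM KN' KN' (sqrt_abs KN' HM' T22') block21;
         F2 = the_reduced_solution KN KN' HM' (adj HM' KN' V) T12'
     in (\<lambda>x\<in>M. block11 x - (1/2) *\<^sub>R (adj KN HM' F (E x) + adj KN KN' F2 (E2 x))))"

end

definition U_op :: "('x::ab_group_add, 'a::zero) hmodule \<Rightarrow> 'x set \<Rightarrow> 'x \<Rightarrow> 'x \<times> 'x" where
  "U_op H M = (\<lambda>h\<in>carrier H. (proj H M h, coproj H M h))"

definition bilateral_shorted ::
  "('x::complex_normed_vector, 'a::cstar_algebra) hmodule \<Rightarrow>
   ('y::complex_normed_vector, 'a) hmodule \<Rightarrow>
   'x set \<Rightarrow> 'y set \<Rightarrow> ('x \<Rightarrow> 'y) \<Rightarrow> 'x \<Rightarrow> 'y" where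
  "bilateral_shorted H K M N T =
    (\<lambda>h\<in>carrier H.
       adj K (hsum (sub K N) (sub K (ortho K N))) (U_op K N)
         (case U_op H M h of (x, y) \<Rightarrow> (shorted_corner H K M N T x, 0)))"

end

theory Submission
  imports Defs
begin

text \<open>
  Let \<open>A = T\<^sub>2\<^sub>2\<close>. The defining equation \<open>|A\<^sup>*|\<^sup>1\<^sup>/\<^sup>2 V\<^sub>A = A\<close> has the companion \<open>V\<^sub>A |A|\<^sup>1\<^sup>/\<^sup>2 = A\<close>, and
  hence \<open>T\<^sub>1\<^sub>2 = F\<^sup>* |A|\<^sup>1\<^sup>/\<^sup>2 = F\<^sub>2\<^sup>* V\<^sub>A\<close>, where \<open>E\<^sub>2\<close> and \<open>F\<^sub>2\<close> stand for the solutions with a tilde. If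
  \<open>T (m + w)\<close> lies in \<open>N\<close>, then \<open>T\<^sub>2\<^sub>1 m = - A w\<close>, so \<open>E m = - |A|\<^sup>1\<^sup>/\<^sup>2 w\<close> and \<open>E\<^sub>2 m = - V\<^sub>A w\<close>; both
  \<open>F\<^sup>* E m\<close> and \<open>F\<^sub>2\<^sup>* E\<^sub>2 m\<close> equal \<open>- T\<^sub>1\<^sub>2 w\<close>, and the shorted operator maps \<open>m\<close> to \<open>T (m + w)\<close>.
  Conversely \<open>E m\<close> is a limit of vectors \<open>|A|\<^sup>1\<^sup>/\<^sup>2 w\<^sub>n\<close> and \<open>E\<^sub>2 m\<close> of vectors \<open>V\<^sub>A v\<^sub>n\<close>, and then
  \<open>T (m - (w\<^sub>n + v\<^sub>n) / 2)\<close> tends to the value of the shorted operator at \<open>m\<close>.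

  Square roots of operators are obtained without spectral theory: they are limits of polynomials
  computed by iteration, and the positivity of \<open>S\<^sup>* S\<close> is reduced to that of \<open>b\<^sup>* b\<close> in the algebra.
\<close>

section \<open>Hilbert modules\<close>

text \<open>What remains is that an adjointable operator is injective on the closure of the range of
  its adjoint. Membership in such closures is shown by approximants with an explicit operator
  factor. This is why the root iteration is kept in the form \<open>Q (root_quot Q n x)\<close>: it
  approximates the root from within the range of \<open>Q\<close>, and replacing the outer
  \<open>Q = |A|\<close> by \<open>A\<close> gives approximants of \<open>V\<close>. The equations
  for \<open>E\<close> and \<open>F2\<close> are posed with \<open>V\<close> or its adjoint, those
  for \<open>F\<close> and \<open>E2\<close> with the roots of \<open>|A|\<close> and
  \<open>|A*|\<close>. Each of the products \<open>F* E\<close> and \<open>F2* E2\<close> thus mixes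
  both kinds, and the closures of the ranges of \<open>V*\<close> and \<open>V\<close> have to be
  compared with those of the two roots.\<close>

lemma scaleC_one [simp]: "1 *\<^sub>C x = (x::'a::complex_vector)"
  using scaleC_of_real[of 1 x] by simp

lemma scaleC_zero_right [simp]: "c *\<^sub>C (0::'a::complex_vector) = 0"
  using scaleC_add_right[of c 0 "0::'a"] by simp

lemma scaleC_minus_right [simp]: "c *\<^sub>C (- x) = - (c *\<^sub>C (x::'a::complex_vector))"
  using scaleC_add_right[of c x "- x"] by (simp add: eq_neg_iff_add_eq_0 add.commute)

lemma scaleC_minus_one [simp]: "(-1) *\<^sub>C x = - (x::'a::complex_vector)"
  using scaleC_of_real[of "-1" x] by simp

lemma scaleC_diff_right: "c *\<^sub>C (x - y) = c *\<^sub>C x - c *\<^sub>C (y::'a::complex_vector)"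
  using scaleC_add_right[of c x "- y"] by simp

lemma scaleC_minus_left [simp]: "(- c) *\<^sub>C x = - (c *\<^sub>C (x::'a::complex_vector))"
  using scaleC_scaleC[of "-1" c x] by simp

lemma scaleC_i_i [simp]: "\<i> *\<^sub>C \<i> *\<^sub>C x = - (x::'a::complex_vector)"
  by (simp add: scaleC_scaleC)

lemma scaleC_scaleR: "c *\<^sub>C r *\<^sub>R x = r *\<^sub>R c *\<^sub>C (x::'a::complex_vector)"
  by (simp add: scaleC_scaleC scaleC_of_real[symmetric] mult.commute)

lemma star_zero [simp]: "star (0::'a::cstar_algebra) = 0"
  using star_add[of 0 "0::'a"] by simp

lemma star_mult_self_eq_0: "star a * a = 0 \<longleftrightarrow> (a::'a::cstar_algebra) = 0"
  using cstar_identity[of a] by auto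

context hilbert_module
begin

lemma scaleR_closed: "x \<in> carrier H \<Longrightarrow> r *\<^sub>R x \<in> carrier H"
  using scaleC_closed[of x "complex_of_real r"] by (simp add: scaleC_of_real)

lemma minus_closed: "x \<in> carrier H \<Longrightarrow> - x \<in> carrier H"
  using scaleR_closed[of x "-1"] by simp

lemma diff_closed: "x \<in> carrier H \<Longrightarrow> y \<in> carrier H \<Longrightarrow> x - y \<in> carrier H"
  using add_closed[of x "- y"] minus_closed by simp

lemmas closed = zero_closed add_closed scaleC_closed scaleR_closed minus_closed diff_closed act_closed

lemma hinner_add_left:
  "\<lbrakk>x \<in> carrier H; y \<in> carrier H; z \<in> carrier H\<rbrakk> \<Longrightarrow> hinner H (x + y) z = hinner H x z + hinner H y z"
  using star_hinner[of z "x + y"] star_hinner[of z x] star_hinner[of z y]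
  by (simp add: hinner_add_right add_closed star_add)

lemma hinner_scaleC_left:
  "\<lbrakk>x \<in> carrier H; y \<in> carrier H\<rbrakk> \<Longrightarrow> hinner H (c *\<^sub>C x) y = cnj c *\<^sub>C hinner H x y"
  using star_hinner[of y "c *\<^sub>C x"] star_hinner[of y x]
  by (simp add: hinner_scaleC_right scaleC_closed star_scaleC)

lemma hinner_scaleR_right:
  "\<lbrakk>x \<in> carrier H; y \<in> carrier H\<rbrakk> \<Longrightarrow> hinner H x (r *\<^sub>R y) = r *\<^sub>R hinner H x y"
  using hinner_scaleC_right[of x y "complex_of_real r"] by (simp add: scaleC_of_real)

lemma hinner_scaleR_left:
  "\<lbrakk>x \<in> carrier H; y \<in> carrier H\<rbrakk> \<Longrightarrow> hinner H (r *\<^sub>R x) y = r *\<^sub>R hinner H x y"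
  using hinner_scaleC_left[of x y "complex_of_real r"] by (simp add: scaleC_of_real)

lemma hinner_minus_right:
  "\<lbrakk>x \<in> carrier H; y \<in> carrier H\<rbrakk> \<Longrightarrow> hinner H x (- y) = - hinner H x y"
  using hinner_scaleR_right[of x y "-1"] by simp

lemma hinner_minus_left:
  "\<lbrakk>x \<in> carrier H; y \<in> carrier H\<rbrakk> \<Longrightarrow> hinner H (- x) y = - hinner H x y"
  using hinner_scaleR_left[of x y "-1"] by simp

lemma hinner_diff_right:
  "\<lbrakk>x \<in> carrier H; y \<in> carrier H; z \<in> carrier H\<rbrakk> \<Longrightarrow> hinner H x (y - z) = hinner H x y - hinner H x z"
  using hinner_add_right[of x y "- z"] by (simp add: hinner_minus_right minus_closed)

lemma hinner_diff_left:
  "\<lbrakk>x \<in> carrier H; y \<in> carrier H; z \<in> carrier H\<rbrakk> \<Longrightarrow> hinner H (x - y) z = hinner H x z - hinner H y z"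
  using hinner_add_left[of x "- y"] by (simp add: hinner_minus_left minus_closed)

lemma hinner_zero_right: "x \<in> carrier H \<Longrightarrow> hinner H x 0 = 0"
  using hinner_add_right[of x 0 0] zero_closed by simp

lemma hinner_zero_left: "x \<in> carrier H \<Longrightarrow> hinner H 0 x = 0"
  using hinner_add_left[of 0 0 x] zero_closed by simp

lemmas hinner_linear = hinner_add_left hinner_add_right hinner_scaleC_left hinner_scaleC_right
  hinner_scaleR_left hinner_scaleR_right hinner_minus_left hinner_minus_right
  hinner_diff_left hinner_diff_right hinner_zero_left hinner_zero_right

lemma norm_power2: "x \<in> carrier H \<Longrightarrow> (norm x)\<^sup>2 = norm (hinner H x x)"
  by (simp add: norm_eq)

lemma eqI_hinner:
  assumes "x \<in> carrier H" "y \<in> carrier H" "\<And>z. z \<in> carrier H \<Longrightarrow> hinner H z x = hinner H z y"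
  shows "x = y"
  using assms hinner_definite[of "x - y"] by (simp add: closed hinner_linear)

text \<open>Cauchy--Schwarz with a wasteful constant, which polarization yields without any order on the
  algebra.\<close>

lemma norm_hinner_le:
  assumes x: "x \<in> carrier H" and y: "y \<in> carrier H"
  shows "norm (hinner H x y) \<le> 4 * norm x * norm y"
proof (cases "x = 0 \<or> y = 0")
  case True
  then show ?thesis using assms hinner_zero_left hinner_zero_right by auto
next
  case False
  have *: "norm (hinner H u v) \<le> 4"
    if u: "u \<in> carrier H" "norm u = 1" and v: "v \<in> carrier H" "norm v = 1" for u v
  proof -
    have b: "norm (hinner H w w) \<le> 4" if "w \<in> carrier H" "norm w \<le> 2" for w
      using power_mono[OF that(2), of 2] norm_power2[OF that(1)] by simp
    have pol: "4 *\<^sub>R hinner H u v = hinner H (u + v) (u + v) - hinner H (u - v) (u - v)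
        + \<i> *\<^sub>C hinner H (u - \<i> *\<^sub>C v) (u - \<i> *\<^sub>C v) - \<i> *\<^sub>C hinner H (u + \<i> *\<^sub>C v) (u + \<i> *\<^sub>C v)"
    proof -
      have 4: "4 *\<^sub>R z = z + z + z + z" for z :: 'a
      proof -
        have "4 *\<^sub>R z = (1 + 1 + 1 + 1) *\<^sub>R z" by simp
        then show ?thesis by (simp only: scaleR_left_distrib scaleR_one)
      qed
      show ?thesis
        unfolding 4 using u v
        by (simp add: closed hinner_linear scaleC_add_right scaleC_diff_right)
    qed
    let ?a = "hinner H (u + v) (u + v)" and ?b = "hinner H (u - v) (u - v)"
      and ?c = "hinner H (u - \<i> *\<^sub>C v) (u - \<i> *\<^sub>C v)" and ?d = "hinner H (u + \<i> *\<^sub>C v) (u + \<i> *\<^sub>C v)"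
    have "norm (u + v) \<le> 2" "norm (u - v) \<le> 2" "norm (u - \<i> *\<^sub>C v) \<le> 2" "norm (u + \<i> *\<^sub>C v) \<le> 2"
      using norm_triangle_ineq[of u v] norm_triangle_ineq4[of u v]
        norm_triangle_ineq[of u "\<i> *\<^sub>C v"] norm_triangle_ineq4[of u "\<i> *\<^sub>C v"] u v
      by (simp_all add: norm_scaleC)
    then have n: "norm ?a \<le> 4" "norm ?b \<le> 4" "norm ?c \<le> 4" "norm ?d \<le> 4"
      using b u v by (simp_all add: closed)
    have "norm (4 *\<^sub>R hinner H u v) \<le> norm ?a + norm ?b + norm (\<i> *\<^sub>C ?c) + norm (\<i> *\<^sub>C ?d)"
      unfolding pol
      using norm_triangle_ineq4[of "?a - ?b + \<i> *\<^sub>C ?c" "\<i> *\<^sub>C ?d"]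
        norm_triangle_ineq[of "?a - ?b" "\<i> *\<^sub>C ?c"] norm_triangle_ineq4[of ?a ?b] by linarith
    then show ?thesis
      using n by (simp add: norm_scaleC)
  qed
  have "norm (hinner H ((1 / norm x) *\<^sub>R x) ((1 / norm y) *\<^sub>R y)) \<le> 4"
    using False assms by (intro *) (auto simp: closed)
  then show ?thesis
    using False assms by (simp add: hinner_linear closed field_simps)
qed

lemma tendsto_hinner_right:
  assumes "X \<longlonglongrightarrow> x" "\<And>n. X n \<in> carrier H" "x \<in> carrier H" "y \<in> carrier H"
  shows "(\<lambda>n. hinner H y (X n)) \<longlonglongrightarrow> hinner H y x"
proof -
  have "(\<lambda>n. 4 * norm y * norm (X n - x)) \<longlonglongrightarrow> 0"
    using tendsto_mult_right_zero tendsto_norm_zero[OF LIM_zero[OF assms(1)]] by blast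
  then have "(\<lambda>n. hinner H y (X n) - hinner H y x) \<longlonglongrightarrow> 0"
    by (rule Lim_null_comparison[rotated])
      (use assms in \<open>auto simp: hinner_diff_right[symmetric] closed norm_hinner_le\<close>)
  then show ?thesis
    by (rule LIM_zero_cancel)
qed

lemma tendsto_hinner_left:
  assumes "X \<longlonglongrightarrow> x" "\<And>n. X n \<in> carrier H" "x \<in> carrier H" "y \<in> carrier H"
  shows "(\<lambda>n. hinner H (X n) y) \<longlonglongrightarrow> hinner H x y"
proof -
  have "(\<lambda>n. 4 * norm (X n - x) * norm y) \<longlonglongrightarrow> 0"
    using tendsto_mult_left_zero tendsto_mult_right_zero tendsto_norm_zero[OF LIM_zero[OF assms(1)]]
    by blast
  then have "(\<lambda>n. hinner H (X n) y - hinner H x y) \<longlonglongrightarrow> 0"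
    by (rule Lim_null_comparison[rotated])
      (use assms in \<open>auto simp: hinner_diff_left[symmetric] closed norm_hinner_le\<close>)
  then show ?thesis
    by (rule LIM_zero_cancel)
qed

lemma closed_carrier: "closed (carrier H)"
  using complete_carrier complete_imp_closed by blast

lemma limit_in_carrier: "X \<longlonglongrightarrow> x \<Longrightarrow> (\<And>n. X n \<in> carrier H) \<Longrightarrow> x \<in> carrier H"
  using closed_carrier closed_sequentially by blast

lemma zero_if_orthogonal_closure:
  assumes "S \<subseteq> carrier H" "x \<in> carrier H" "\<And>y. y \<in> S \<Longrightarrow> hinner H x y = 0" "y \<in> closure S"
  shows "hinner H x y = 0"
proof -
  obtain Y where Y: "\<And>n. Y n \<in> S" "Y \<longlonglongrightarrow> y"
    using assms(4) closure_sequential by metis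
  then have "Y n \<in> carrier H" for n
    using assms by blast
  moreover from this have "y \<in> carrier H"
    using Y limit_in_carrier by blast
  ultimately have "(\<lambda>n. hinner H x (Y n)) \<longlonglongrightarrow> hinner H x y"
    using tendsto_hinner_right Y assms by blast
  then show ?thesis
    using assms Y by (simp add: LIMSEQ_const_iff)
qed

text \<open>Only the carrier is known to be complete, not the ambient type, so Baire's theorem is
  applied in the metric restricted to the carrier.\<close>

lemma Baire_carrier:
  fixes F :: "nat \<Rightarrow> 'x set"
  assumes cl: "\<And>n. closed (F n)" and cov: "carrier H \<subseteq> (\<Union>n. F n)"
  obtains n x e where "x \<in> carrier H" "e > 0" "\<And>y. y \<in> carrier H \<Longrightarrow> dist x y < e \<Longrightarrow> y \<in> F n"
proof -
  interpret S: Submetric UNIV dist "carrier H"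
    by unfold_locales auto
  have top: "S.sub.mtopology = top_of_set (carrier H)"
    using S.mtopology_submetric by (simp)
  have "S.sub.mcomplete"
    unfolding S.sub.mcomplete_def
  proof (intro strip)
    fix \<sigma> assume "S.sub.MCauchy \<sigma>"
    then have \<sigma>: "range \<sigma> \<subseteq> carrier H" "Cauchy \<sigma>"
      using S.MCauchy_submetric by auto
    then obtain l where "l \<in> carrier H" "\<sigma> \<longlonglongrightarrow> l"
      using complete_carrier unfolding complete_def by blast
    then show "\<exists>x. limitin S.sub.mtopology \<sigma> x sequentially"
      using \<sigma> by (intro exI[of _ l]) (auto simp: top limitin_subtopology subset_eq)
  qed
  note B = S.sub.metric_Baire_category_alt[OF this, of "range (\<lambda>n. carrier H \<inter> F n)"]
  show thesis
  proof (rule ccontr)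
    assume no: "\<not> thesis"
    have "S.sub.mtopology interior_of (carrier H \<inter> F n) = {}" for n
    proof (rule ccontr)
      assume "S.sub.mtopology interior_of (carrier H \<inter> F n) \<noteq> {}"
      then obtain x where x: "x \<in> S.sub.mtopology interior_of (carrier H \<inter> F n)"
        by blast
      then obtain U where U: "openin (top_of_set (carrier H)) U" "x \<in> U" "U \<subseteq> carrier H \<inter> F n"
        unfolding interior_of_def top by blast
      then obtain e where "e > 0" "ball x e \<inter> carrier H \<subseteq> U"
        by (meson openin_contains_ball)
      then show False
        using U no that[of x e n] by (auto simp: subset_eq)
    qed
    moreover have "closedin S.sub.mtopology (carrier H \<inter> F n)" for n
      using cl top closedin_closed_Int by metis
    ultimately have "S.sub.mtopology interior_of (\<Union>n. carrier H \<inter> F n) = {}"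
      by (intro B) auto
    moreover have "(\<Union>n. carrier H \<inter> F n) = carrier H"
      using cov by blast
    ultimately show False
      using zero_closed interior_of_topspace[of S.sub.mtopology] by (auto simp: top)
  qed
qed

end

context hilbert_module
begin

text \<open>The limit is named by \<open>lim\<close> so that a pointwise limit of operators is again
  given by a term; the modulus \<open>e\<close> passes to the limit.\<close>

lemma convergent_in_carrier:
  assumes X: "\<And>n. X n \<in> carrier H"
    and e: "\<And>m n. m \<le> n \<Longrightarrow> norm (X m - X n) \<le> e m" "e \<longlonglongrightarrow> (0::real)"
  shows "X \<longlonglongrightarrow> lim X" "lim X \<in> carrier H" "norm (X m - lim X) \<le> e m"
proof -
  have "Cauchy X"
  proof (rule metric_CauchyI)
    fix r :: real assume "r > 0"
    then obtain N where N: "\<And>n. n \<ge> N \<Longrightarrow> e n < r"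
      using order_tendstoD(2)[OF e(2)] unfolding eventually_sequentially by blast
    have "dist (X m) (X n) < r" if "m \<ge> N" "n \<ge> N" for m n
    proof (cases "m \<le> n")
      case True
      then show ?thesis using e(1)[OF True] N[of m] that by (simp add: dist_norm)
    next
      case False
      then have "n \<le> m" by simp
      then show ?thesis using e(1)[of n m] N[of n] that by (simp add: dist_norm norm_minus_commute)
    qed
    then show "\<exists>M. \<forall>m\<ge>M. \<forall>n\<ge>M. dist (X m) (X n) < r" by blast
  qed
  then obtain l where l: "l \<in> carrier H" "X \<longlonglongrightarrow> l"
    using complete_carrier X unfolding complete_def by meson
  then have "lim X = l" by (simp add: limI)
  then show "X \<longlonglongrightarrow> lim X" "lim X \<in> carrier H" using l by auto
  then have "(\<lambda>n. norm (X m - X n)) \<longlonglongrightarrow> norm (X m - lim X)"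
    by (intro tendsto_intros)
  then show "norm (X m - lim X) \<le> e m"
    by (rule LIMSEQ_le_const2) (use e in blast)
qed

end

section \<open>Adjoint pairs\<close>

text \<open>The relation \<^const>\<open>is_adjoint\<close> without extensionality, so that plain compositions and linear
  combinations of operators may be used.\<close>

definition adjoints ::
  "('x, 'a) hmodule \<Rightarrow> ('y, 'a) hmodule \<Rightarrow> ('x \<Rightarrow> 'y) \<Rightarrow> ('y \<Rightarrow> 'x) \<Rightarrow> bool" where
  "adjoints H K T S \<longleftrightarrow>
     (\<forall>x\<in>carrier H. T x \<in> carrier K) \<and> (\<forall>y\<in>carrier K. S y \<in> carrier H) \<and>
     (\<forall>x\<in>carrier H. \<forall>y\<in>carrier K. hinner K (T x) y = hinner H x (S y))"

lemma adjoints_carrier: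
  assumes "adjoints H K T S"
  shows "x \<in> carrier H \<Longrightarrow> T x \<in> carrier K" "y \<in> carrier K \<Longrightarrow> S y \<in> carrier H"
  using assms by (auto simp: adjoints_def)

lemma adjoints_hinner:
  assumes "adjoints H K T S" "x \<in> carrier H" "y \<in> carrier K"
  shows "hinner K (T x) y = hinner H x (S y)"
  using assms by (auto simp: adjoints_def)

lemma adjoints_compose:
  assumes "adjoints H K T S" "adjoints K L T' S'"
  shows "adjoints H L (\<lambda>x. T' (T x)) (\<lambda>z. S (S' z))"
  using assms by (auto simp: adjoints_def)

lemma adjoints_id: "adjoints H H (\<lambda>x. x) (\<lambda>x. x)"
  by (simp add: adjoints_def)

lemma adjoints_cong:
  assumes "adjoints H K T S" "\<And>x. x \<in> carrier H \<Longrightarrow> T' x = T x" "\<And>y. y \<in> carrier K \<Longrightarrow> S' y = S y"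
  shows "adjoints H K T' S'"
  using assms by (auto simp: adjoints_def)

locale hilbert_pair = H: hilbert_module H + K: hilbert_module K
  for H :: "('x::complex_normed_vector, 'a::cstar_algebra) hmodule"
    and K :: "('y::complex_normed_vector, 'a) hmodule"
begin

lemma adjoints_sym: "adjoints H K T S \<Longrightarrow> adjoints K H S T"
  unfolding adjoints_def
  by (metis H.star_hinner K.star_hinner)

lemma adjoints_add:
  assumes T: "adjoints H K T S" and xy: "x \<in> carrier H" "y \<in> carrier H"
  shows "T (x + y) = T x + T y"
proof (rule K.eqI_hinner)
  note S = adjoints_sym[OF T]
  fix z assume z: "z \<in> carrier K"
  show "hinner K z (T (x + y)) = hinner K z (T x + T y)"
    using z xy adjoints_carrier[OF T]
    by (simp add: H.closed K.hinner_add_right H.hinner_add_right adjoints_hinner[OF S, symmetric])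
qed (use xy adjoints_carrier[OF T] in \<open>simp_all add: H.closed K.closed\<close>)

lemma adjoints_scaleC:
  assumes T: "adjoints H K T S" and x: "x \<in> carrier H"
  shows "T (c *\<^sub>C x) = c *\<^sub>C T x"
proof (rule K.eqI_hinner)
  note S = adjoints_sym[OF T]
  fix z assume z: "z \<in> carrier K"
  show "hinner K z (T (c *\<^sub>C x)) = hinner K z (c *\<^sub>C T x)"
    using z x adjoints_carrier[OF T]
    by (simp add: H.closed K.hinner_scaleC_right H.hinner_scaleC_right
        adjoints_hinner[OF S, symmetric])
qed (use x adjoints_carrier[OF T] in \<open>simp_all add: H.closed K.closed\<close>)

lemma adjoints_scaleR:
  assumes T: "adjoints H K T S" and x: "x \<in> carrier H"
  shows "T (r *\<^sub>R x) = r *\<^sub>R T x"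
  using adjoints_scaleC[OF assms, of "complex_of_real r"] by (simp add: scaleC_of_real)

lemma adjoints_minus:
  assumes T: "adjoints H K T S" and x: "x \<in> carrier H"
  shows "T (- x) = - T x"
  using adjoints_scaleR[OF assms, of "-1"] by simp

lemma adjoints_diff:
  assumes T: "adjoints H K T S" and xy: "x \<in> carrier H" "y \<in> carrier H"
  shows "T (x - y) = T x - T y"
  using adjoints_add[OF T, of x "- y"] xy by (simp add: H.closed adjoints_minus[OF T])

lemma adjoints_zero:
  assumes T: "adjoints H K T S"
  shows "T 0 = 0"
  using adjoints_add[OF T H.zero_closed H.zero_closed] by simp

lemmas adjoints_linear = adjoints_add adjoints_scaleC adjoints_scaleR adjoints_minus adjoints_diff
  adjoints_zero

text \<open>A uniform boundedness argument. The sets \<open>F n\<close> are cut out by inner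
  products with \<open>S y\<close>, which are continuous in \<open>x\<close>; sets given by
  \<open>norm (T x)\<close> could not be seen to be closed before \<open>T\<close> is known to be
  continuous.\<close>

lemma adjoints_bounded:
  assumes T: "adjoints H K T S"
  obtains c where "c > 0" "\<And>x. x \<in> carrier H \<Longrightarrow> norm (T x) \<le> c * norm x"
proof -
  define F where "F n = {x \<in> carrier H. \<forall>y\<in>carrier K. norm (hinner H x (S y)) \<le> real n * norm y}" for n
  note c = adjoints_carrier[OF T]
  have "closed (F n)" for n
    unfolding closed_sequential_limits
  proof (intro allI impI, elim conjE)
    fix X l assume X: "\<forall>k. X k \<in> F n" "X \<longlonglongrightarrow> l"
    then have l: "l \<in> carrier H" using H.limit_in_carrier F_def by blast
    moreover have "norm (hinner H l (S y)) \<le> real n * norm y" if y: "y \<in> carrier K" for y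
    proof -
      have "(\<lambda>k. norm (hinner H (X k) (S y))) \<longlonglongrightarrow> norm (hinner H l (S y))"
        using X l y c F_def by (intro tendsto_norm H.tendsto_hinner_left) auto
      then show ?thesis
        by (rule LIMSEQ_le_const2) (use X y F_def in blast)
    qed
    ultimately show "l \<in> F n" by (simp add: F_def)
  qed
  moreover have "carrier H \<subseteq> (\<Union>n. F n)"
  proof
    fix x assume x: "x \<in> carrier H"
    \<comment> \<open>The 4 is the constant of \<open>norm_hinner_le\<close>.\<close>
    obtain n where n: "4 * norm (T x) \<le> real n" using real_arch_simple by blast
    have "norm (hinner H x (S y)) \<le> real n * norm y" if y: "y \<in> carrier K" for y
      using K.norm_hinner_le[of "T x" y] c x y mult_right_mono[OF n norm_ge_zero[of y]]
      by (simp add: adjoints_hinner[OF T])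
    then show "x \<in> (\<Union>n. F n)" using x by (auto simp: F_def)
  qed
  ultimately obtain n x0 e where e: "x0 \<in> carrier H" "e > 0"
      "\<And>y. y \<in> carrier H \<Longrightarrow> dist x0 y < e \<Longrightarrow> y \<in> F n"
    using H.Baire_carrier by metis
  \<comment> \<open>Testing with \<open>y = T w\<close> and writing \<open>w\<close> as the
    difference of \<open>x0 + w\<close> and \<open>x0\<close>, both in \<open>F n\<close>, costs the
    factor 2.\<close>
  have small: "norm (T w) \<le> 2 * real n" if w: "w \<in> carrier H" "norm w < e" for w
  proof -
    have F: "x0 \<in> F n" "x0 + w \<in> F n" using e w by (auto simp: dist_norm H.closed)
    have "hinner K (T w) (T w) = hinner H (x0 + w) (S (T w)) - hinner H x0 (S (T w))"
      using w e c by (simp add: adjoints_hinner[OF T] H.hinner_add_left)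
    also have "norm \<dots> \<le> real n * norm (T w) + real n * norm (T w)"
      using F w c unfolding F_def by (intro norm_triangle_le_diff add_mono) auto
    finally have "norm (T w) * norm (T w) \<le> 2 * real n * norm (T w)"
      using K.norm_power2[of "T w"] w c by (simp add: power2_eq_square)
    then show ?thesis
      by (cases "norm (T w) = 0") (auto)
  qed
  \<comment> \<open>The summand 1 keeps the constant positive when \<open>n = 0\<close>.\<close>
  have "norm (T x) \<le> (4 * real n / e + 1) * norm x" if x: "x \<in> carrier H" for x
  proof (cases "x = 0")
    case True
    then show ?thesis using adjoints_zero[OF T] by simp
  next
    case False
    have "norm (T ((e / (2 * norm x)) *\<^sub>R x)) \<le> 2 * real n"
      using False x e by (intro small) (auto simp: H.closed)
    then have "norm (T x) \<le> 4 * real n / e * norm x"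
      using False x e by (simp add: adjoints_scaleR[OF T] field_simps)
    then show ?thesis unfolding distrib_right using norm_ge_zero[of x] by linarith
  qed
  moreover have "4 * real n / e + 1 > 0"
    using e by (simp add: add_nonneg_pos)
  ultimately show thesis using that by blast
qed

lemma adjoints_tendsto:
  assumes T: "adjoints H K T S" and X: "X \<longlonglongrightarrow> x" "\<And>n. X n \<in> carrier H" "x \<in> carrier H"
  shows "(\<lambda>n. T (X n)) \<longlonglongrightarrow> T x"
proof -
  obtain c where c: "c > 0" "\<And>x. x \<in> carrier H \<Longrightarrow> norm (T x) \<le> c * norm x"
    using adjoints_bounded[OF T] by blast
  have "(\<lambda>n. c * norm (X n - x)) \<longlonglongrightarrow> 0"
    using tendsto_mult_right_zero tendsto_norm_zero[OF LIM_zero[OF X(1)]] by blast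
  then have "(\<lambda>n. T (X n) - T x) \<longlonglongrightarrow> 0"
    by (rule Lim_null_comparison[rotated])
      (use X c in \<open>auto simp: adjoints_diff[OF T, symmetric] H.closed\<close>)
  then show ?thesis by (rule LIM_zero_cancel)
qed

lemma adjoints_comb:
  assumes "adjoints H K T S" "adjoints H K T' S'"
  shows "adjoints H K (\<lambda>x. a *\<^sub>R T x + b *\<^sub>R T' x) (\<lambda>y. a *\<^sub>R S y + b *\<^sub>R S' y)"
  using assms by (simp add: adjoints_def H.closed K.closed H.hinner_linear K.hinner_linear)

lemma adjoints_scale:
  assumes "adjoints H K T S"
  shows "adjoints H K (\<lambda>x. c *\<^sub>C T x) (\<lambda>y. cnj c *\<^sub>C S y)"
  using assms by (simp add: adjoints_def H.closed K.closed H.hinner_linear K.hinner_linear)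

lemma adjoints_unique:
  assumes "adjoints H K T S" "adjoints H K T S'" "y \<in> carrier K"
  shows "S y = S' y"
  using assms by (intro H.eqI_hinner) (auto simp: adjoints_def)

text \<open>An estimate for the \<open>T n\<close> alone suffices: for
  \<open>d = S m y - S n y\<close> the inner square of \<open>d\<close> is the inner product of
  \<open>T m d - T n d\<close> with \<open>y\<close>, and dividing by \<open>norm d\<close> carries
  the estimate over to the adjoints with a factor 4.\<close>

lemma adjoints_limit:
  assumes A: "\<And>n. adjoints H K (T n) (S n)"
    and e: "\<And>m n x. m \<le> n \<Longrightarrow> x \<in> carrier H \<Longrightarrow> norm (T m x - T n x) \<le> e m * norm x"
      "e \<longlonglongrightarrow> (0::real)" and e0: "\<And>n. 0 \<le> e n"
  shows "adjoints H K (\<lambda>x. lim (\<lambda>n. T n x)) (\<lambda>y. lim (\<lambda>n. S n y))"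
    and "x \<in> carrier H \<Longrightarrow> (\<lambda>n. T n x) \<longlonglongrightarrow> lim (\<lambda>n. T n x)"
    and "x \<in> carrier H \<Longrightarrow> norm (T m x - lim (\<lambda>n. T n x)) \<le> e m * norm x"
proof -
  note c = adjoints_carrier[OF A]
  have T: "(\<lambda>n. T n x) \<longlonglongrightarrow> lim (\<lambda>n. T n x)" "lim (\<lambda>n. T n x) \<in> carrier K"
    "norm (T m x - lim (\<lambda>n. T n x)) \<le> e m * norm x" if x: "x \<in> carrier H" for x m
    using K.convergent_in_carrier[of "\<lambda>n. T n x" "\<lambda>n. e n * norm x"] x c e
      tendsto_mult_left_zero[OF e(2)] by auto
  have Se: "norm (S m y - S n y) \<le> e m * (4 * norm y)" if mn: "m \<le> n" and y: "y \<in> carrier K" for m n y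
  proof -
    define d where "d = S m y - S n y"
    have d: "d \<in> carrier H" using y c by (simp add: d_def H.closed)
    have "(norm d)\<^sup>2 = norm (hinner H d (S m y - S n y))"
      using d H.norm_power2 d_def by simp
    also have "hinner H d (S m y - S n y) = hinner K (T m d - T n d) y"
      using c d y by (simp add: H.hinner_diff_right K.hinner_diff_left adjoints_hinner[OF A])
    also have "norm \<dots> \<le> 4 * norm (T m d - T n d) * norm y"
      using c d y by (intro K.norm_hinner_le) (auto simp: K.closed)
    also have "\<dots> \<le> 4 * (e m * norm d) * norm y"
      using e(1)[OF mn d] by (intro mult_right_mono mult_left_mono) auto
    finally have *: "norm d * norm d \<le> (e m * (4 * norm y)) * norm d"
      by (simp add: power2_eq_square algebra_simps)
    show ?thesis
      using * e0[of m] by (cases "d = 0") (auto simp: d_def)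
  qed
  have S: "(\<lambda>n. S n y) \<longlonglongrightarrow> lim (\<lambda>n. S n y)" "lim (\<lambda>n. S n y) \<in> carrier H"
    if y: "y \<in> carrier K" for y
    using H.convergent_in_carrier[of "\<lambda>n. S n y" "\<lambda>n. e n * (4 * norm y)"] y c Se
      tendsto_mult_left_zero[OF e(2)] by auto
  have "hinner K (lim (\<lambda>n. T n x)) y = hinner H x (lim (\<lambda>n. S n y))"
    if x: "x \<in> carrier H" and y: "y \<in> carrier K" for x y
  proof (rule LIMSEQ_unique)
    show "(\<lambda>n. hinner K (T n x) y) \<longlonglongrightarrow> hinner K (lim (\<lambda>n. T n x)) y"
      using T S c x y by (intro K.tendsto_hinner_left) auto
    show "(\<lambda>n. hinner K (T n x) y) \<longlonglongrightarrow> hinner H x (lim (\<lambda>n. S n y))"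
      unfolding adjoints_hinner[OF A x y] using T S c x y by (intro H.tendsto_hinner_right) auto
  qed
  then show "adjoints H K (\<lambda>x. lim (\<lambda>n. T n x)) (\<lambda>y. lim (\<lambda>n. S n y))"
    using T S by (auto simp: adjoints_def)
  show "x \<in> carrier H \<Longrightarrow> (\<lambda>n. T n x) \<longlonglongrightarrow> lim (\<lambda>n. T n x)"
    and "x \<in> carrier H \<Longrightarrow> norm (T m x - lim (\<lambda>n. T n x)) \<le> e m * norm x"
    using T by auto
qed

end

section \<open>Square roots of positive operators\<close>

text \<open>A self-adjoint operator with \<open>\<parallel>t - A\<parallel> \<le> t\<close>. In a C*-algebra this says that \<open>A\<close> is positive and
  \<open>\<parallel>A\<parallel> \<le> 2 t\<close>, but it is visibly stable under sums, and it is the condition under which the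
  iteration for the square root converges.\<close>

definition pos_bound :: "('x::real_normed_vector, 'a) hmodule \<Rightarrow> real \<Rightarrow> ('x \<Rightarrow> 'x) \<Rightarrow> bool" where
  "pos_bound H t A \<longleftrightarrow>
     t > 0 \<and> adjoints H H A A \<and> (\<forall>x\<in>carrier H. norm (t *\<^sub>R x - A x) \<le> t * norm x)"

definition positive_op :: "('x::real_normed_vector, 'a) hmodule \<Rightarrow> ('x \<Rightarrow> 'x) \<Rightarrow> bool" where
  "positive_op H A \<longleftrightarrow> (\<exists>t. pos_bound H t A)"

lemma positiveI: "pos_bound H t A \<Longrightarrow> positive_op H A"
  by (auto simp: positive_op_def)

lemma positive_adjoints: "positive_op H A \<Longrightarrow> adjoints H H A A"
  by (auto simp: positive_op_def pos_bound_def)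

text \<open>This is the iteration below for \<open>Q = 0\<close>. It dominates the operator iterates
  and their increments, so its monotone convergence to 1 forces uniform convergence of the
  operators.\<close>

primrec root_val :: "nat \<Rightarrow> real" where
  "root_val 0 = 0"
| "root_val (Suc n) = (1 + (root_val n)\<^sup>2) / 2"

text \<open>The iteration \<open>Y \<mapsto> (1 - Q + Y\<^sup>2) / 2\<close> for \<open>1 - Q\<^sup>1\<^sup>/\<^sup>2\<close>, started at \<open>0\<close>. Its members are polynomials
  in \<open>Q\<close> with constant terms \<open>root_val n\<close>, and \<open>root_quot Q n\<close> is \<open>(root_val n - Y) / Q\<close>.\<close>

primrec root_quot :: "('x::real_vector \<Rightarrow> 'x) \<Rightarrow> nat \<Rightarrow> 'x \<Rightarrow> 'x" where
  "root_quot Q 0 x = 0"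
| "root_quot Q (Suc n) x =
     (1/2) *\<^sub>R (x + (2 * root_val n) *\<^sub>R root_quot Q n x - root_quot Q n (Q (root_quot Q n x)))"

lemma root_val_bounds: "0 \<le> root_val n" "root_val n \<le> 1"
proof (induction n)
  case (Suc n)
  { case 1 then show ?case by simp }
  { case 2 then show ?case using Suc by (simp add: power_le_one) }
qed auto

lemma root_val_mono: "root_val n \<le> root_val (Suc n)"
proof -
  have "0 \<le> (1 - root_val n)\<^sup>2" by simp
  then show ?thesis by (simp add: power2_eq_square algebra_simps)
qed

lemma root_val_tendsto: "root_val \<longlonglongrightarrow> 1"
proof -
  have "incseq root_val"
    by (rule incseq_SucI) (rule root_val_mono)
  then obtain l where l: "root_val \<longlonglongrightarrow> l"
    using incseq_convergent[of root_val 1] root_val_bounds by metis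
  have "(\<lambda>n. root_val (Suc n)) \<longlonglongrightarrow> (1 + l\<^sup>2) / 2"
    unfolding root_val.simps using l by (intro tendsto_intros) auto
  then have "l = (1 + l\<^sup>2) / 2"
    using LIMSEQ_unique l LIMSEQ_Suc by blast
  then have "(l - 1)\<^sup>2 = 0" by (simp add: power2_eq_square algebra_simps)
  then show ?thesis using l by simp
qed

sublocale hilbert_module \<subseteq> self: hilbert_pair H H
  by unfold_locales

context hilbert_module
begin

lemma adjoints_root_quot:
  assumes Q: "adjoints H H Q Q"
  shows "adjoints H H (root_quot Q n) (root_quot Q n)"
proof (induction n)
  case 0
  then show ?case by (simp add: adjoints_def closed hinner_linear)
next
  case (Suc n)
  have "adjoints H H (\<lambda>x. (1/2) *\<^sub>R (1 *\<^sub>R x + (2 * root_val n) *\<^sub>R root_quot Q n x)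
      + (-1/2) *\<^sub>R root_quot Q n (Q (root_quot Q n x)))
    (\<lambda>x. (1/2) *\<^sub>R (1 *\<^sub>R x + (2 * root_val n) *\<^sub>R root_quot Q n x)
      + (-1/2) *\<^sub>R root_quot Q n (Q (root_quot Q n x)))"
    by (rule self.adjoints_comb[OF self.adjoints_comb[OF adjoints_id Suc]
          adjoints_compose[OF adjoints_compose[OF Suc Q] Suc]])
  then show ?case
    by (rule adjoints_cong) (simp_all add: algebra_simps)
qed

end

context hilbert_pair
begin

lemma root_quot_intertwine:
  assumes Q: "adjoints H H Q Q" and Q': "adjoints K K Q' Q'" and Z: "adjoints H K Z Z'"
    and ZQ: "\<And>x. x \<in> carrier H \<Longrightarrow> Z (Q x) = Q' (Z x)"
  shows "x \<in> carrier H \<Longrightarrow> Z (root_quot Q n x) = root_quot Q' n (Z x)"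
proof (induction n arbitrary: x)
  case 0
  then show ?case by (simp add: adjoints_zero[OF Z])
next
  case (Suc n)
  note c = adjoints_carrier[OF Q] adjoints_carrier[OF H.adjoints_root_quot[OF Q]]
  show ?case
    using Suc.prems c
    by (simp add: adjoints_linear[OF Z] H.closed Suc.IH ZQ)
qed

end

section \<open>Convergence of the root iteration for operators of bound 1\<close>

context hilbert_module
begin

context
  fixes Q
  assumes Q: "pos_bound H 1 Q"
begin

lemma Q_adj: "adjoints H H Q Q" and Q_bound: "x \<in> carrier H \<Longrightarrow> norm (x - Q x) \<le> norm x"
  using Q by (auto simp: pos_bound_def)

lemmas quot_adj = adjoints_root_quot[OF Q_adj]
lemmas quot_carrier = adjoints_carrier[OF Q_adj] adjoints_carrier[OF quot_adj]

lemma quot_commute: "x \<in> carrier H \<Longrightarrow> root_quot Q n (Q x) = Q (root_quot Q n x)"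
  using self.root_quot_intertwine[OF Q_adj Q_adj Q_adj] by simp

definition "root_Y n x = root_val n *\<^sub>R x - Q (root_quot Q n x)"

lemma root_Y_carrier: "x \<in> carrier H \<Longrightarrow> root_Y n x \<in> carrier H"
  using quot_carrier by (simp add: root_Y_def closed)

lemma root_Y_Suc:
  assumes x: "x \<in> carrier H"
  shows "root_Y (Suc n) x = (1/2) *\<^sub>R (x - Q x + root_Y n (root_Y n x))"
proof -
  have "(r / 2) *\<^sub>R z + ((r / 2) *\<^sub>R z + w) = r *\<^sub>R z + w" for r and z w :: 'x
    by (simp add: add.assoc[symmetric] scaleR_left_distrib[symmetric])
  then show ?thesis
    unfolding root_Y_def using x quot_carrier
    by (simp add: self.adjoints_linear[OF Q_adj] self.adjoints_linear[OF quot_adj] closed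
        quot_commute power2_eq_square add_divide_distrib algebra_simps)
qed

lemma root_Y_diff:
  assumes "x \<in> carrier H" "y \<in> carrier H"
  shows "root_Y n (x - y) = root_Y n x - root_Y n y"
  unfolding root_Y_def using assms quot_carrier
  by (simp add: self.adjoints_linear[OF Q_adj] self.adjoints_linear[OF quot_adj] closed algebra_simps)

lemma root_Y_bound: "x \<in> carrier H \<Longrightarrow> norm (root_Y n x) \<le> root_val n * norm x"
proof (induction n arbitrary: x)
  case 0
  then show ?case by (simp add: root_Y_def self.adjoints_zero[OF Q_adj])
next
  case (Suc n)
  have "norm (root_Y n (root_Y n x)) \<le> root_val n * (root_val n * norm x)"
    using Suc.IH[OF root_Y_carrier[OF Suc.prems]] Suc.IH[OF Suc.prems]
    by (meson mult_left_mono order_trans root_val_bounds(1))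
  moreover have "norm (x - Q x + root_Y n (root_Y n x)) \<le> norm (x - Q x) + norm (root_Y n (root_Y n x))"
    by (rule norm_triangle_ineq)
  ultimately have "norm (x - Q x + root_Y n (root_Y n x)) \<le> norm x + root_val n * (root_val n * norm x)"
    using Q_bound[OF Suc.prems] by linarith
  then show ?case
    by (simp add: root_Y_Suc[OF Suc.prems] power2_eq_square distrib_right mult.assoc)
qed

text \<open>For successive iterates \<open>p\<close> and \<open>q\<close>,
  \<open>p p - q q = p (p - q) + (p - q) q\<close>. The induction hypothesis at \<open>x\<close> and
  at \<open>q x\<close> bounds the two terms, and the scalar iteration satisfies the same recursion
  with equality.\<close>

lemma root_Y_step:
  "x \<in> carrier H \<Longrightarrow> norm (root_Y (Suc n) x - root_Y n x) \<le> (root_val (Suc n) - root_val n) * norm x"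
proof (induction n arbitrary: x)
  case 0
  then show ?case using root_Y_bound[OF 0, of "Suc 0"] by (simp add: root_Y_def self.adjoints_zero[OF Q_adj])
next
  case (Suc n)
  let ?y = "root_Y (Suc n) x" and ?z = "root_Y n x"
  let ?d = "root_val (Suc n) - root_val n"
  note x = Suc.prems and yc = root_Y_carrier[OF Suc.prems]
  have "root_Y (Suc (Suc n)) x - ?y = (1/2) *\<^sub>R (root_Y (Suc n) ?y - root_Y n ?z)"
    unfolding root_Y_Suc[OF x, of "Suc n"]
    by (subst (2) root_Y_Suc[OF x]) (simp add: algebra_simps)
  also have "root_Y (Suc n) ?y - root_Y n ?z
      = root_Y (Suc n) (?y - ?z) + (root_Y (Suc n) ?z - root_Y n ?z)"
    using yc by (simp add: root_Y_diff)
  finally have "norm (root_Y (Suc (Suc n)) x - ?y)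
      \<le> (norm (root_Y (Suc n) (?y - ?z)) + norm (root_Y (Suc n) ?z - root_Y n ?z)) / 2"
    by (simp add: norm_triangle_ineq)
  also have "\<dots> \<le> (root_val (Suc n) * (?d * norm x) + ?d * (root_val n * norm x)) / 2"
  proof (intro divide_right_mono add_mono)
    have "norm (root_Y (Suc n) (?y - ?z)) \<le> root_val (Suc n) * norm (?y - ?z)"
      using yc by (intro root_Y_bound) (simp add: closed)
    also have "\<dots> \<le> root_val (Suc n) * (?d * norm x)"
      using Suc.IH[OF x] root_val_bounds by (intro mult_left_mono) auto
    finally show "norm (root_Y (Suc n) (?y - ?z)) \<le> root_val (Suc n) * (?d * norm x)" .
    have "norm (root_Y (Suc n) ?z - root_Y n ?z) \<le> ?d * norm ?z"
      using yc by (intro Suc.IH)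
    also have "\<dots> \<le> ?d * (root_val n * norm x)"
      using root_Y_bound[OF x] root_val_mono[of n] by (intro mult_left_mono) auto
    finally show "norm (root_Y (Suc n) ?z - root_Y n ?z) \<le> ?d * (root_val n * norm x)" .
  qed simp
  also have "\<dots> = (root_val (Suc (Suc n)) - root_val (Suc n)) * norm x"
    by (subst root_val.simps(2), subst (5) root_val.simps(2))
      (simp del: root_val.simps add: power2_eq_square algebra_simps add_divide_distrib diff_divide_distrib)
  finally show ?case .
qed

lemma root_Y_Cauchy:
  assumes x: "x \<in> carrier H" and "m \<le> n"
  shows "norm (root_Y n x - root_Y m x) \<le> (root_val n - root_val m) * norm x"
  using \<open>m \<le> n\<close>
proof (induction n rule: dec_induct)
  case (step n)
  have "norm (root_Y (Suc n) x - root_Y m x)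
      \<le> norm (root_Y (Suc n) x - root_Y n x) + norm (root_Y n x - root_Y m x)"
    using norm_triangle_ineq[of "root_Y (Suc n) x - root_Y n x" "root_Y n x - root_Y m x"] by simp
  then show ?case
    using step.IH root_Y_step[OF x, of n] by (simp del: root_val.simps add: algebra_simps)
qed simp

definition "usqrt x = lim (\<lambda>n. Q (root_quot Q n x))"

lemma root_approx_Cauchy:
  assumes x: "x \<in> carrier H" and mn: "m \<le> n"
  shows "norm (Q (root_quot Q m x) - Q (root_quot Q n x)) \<le> 2 * (1 - root_val m) * norm x"
proof -
  have mono: "root_val m \<le> root_val n"
    using mn root_val_mono by (simp add: incseq_SucI incseqD)
  have "norm (Q (root_quot Q m x) - Q (root_quot Q n x))
      = norm ((root_Y n x - root_Y m x) - (root_val n - root_val m) *\<^sub>R x)"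
    by (simp add: root_Y_def algebra_simps)
  also have "\<dots> \<le> (root_val n - root_val m) * norm x + (root_val n - root_val m) * norm x"
    using root_Y_Cauchy[OF x mn] mono by (intro order_trans[OF norm_triangle_ineq4 add_mono]) auto
  also have "\<dots> = 2 * (root_val n - root_val m) * norm x" by (simp add: algebra_simps)
  also have "\<dots> \<le> 2 * (1 - root_val m) * norm x"
    using root_val_bounds[of n] by (intro mult_right_mono) auto
  finally show ?thesis .
qed

lemma root_err_tendsto: "(\<lambda>n. 2 * (1 - root_val n)) \<longlonglongrightarrow> 0"
  using tendsto_mult[OF tendsto_const[of 2] tendsto_diff[OF tendsto_const[of 1] root_val_tendsto]]
  by simp

lemma approx_adj: "adjoints H H (\<lambda>x. Q (root_quot Q n x)) (\<lambda>x. Q (root_quot Q n x))"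
  by (rule adjoints_cong[OF adjoints_compose[OF quot_adj Q_adj]]) (simp_all add: quot_commute)

lemma root_adj: "adjoints H H usqrt usqrt"
  and root_tendsto: "x \<in> carrier H \<Longrightarrow> (\<lambda>n. Q (root_quot Q n x)) \<longlonglongrightarrow> usqrt x"
  and root_err: "x \<in> carrier H \<Longrightarrow> norm (Q (root_quot Q m x) - usqrt x) \<le> 2 * (1 - root_val m) * norm x"
  unfolding usqrt_def[abs_def]
  using self.adjoints_limit[OF approx_adj root_approx_Cauchy root_err_tendsto] root_val_bounds by auto

lemma root_Y_tendsto:
  assumes "x \<in> carrier H"
  shows "(\<lambda>n. root_Y n x) \<longlonglongrightarrow> x - usqrt x"
proof -
  have "(\<lambda>n. root_val n *\<^sub>R x - Q (root_quot Q n x)) \<longlonglongrightarrow> 1 *\<^sub>R x - usqrt x"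
    by (intro tendsto_intros root_val_tendsto root_tendsto assms)
  then show ?thesis by (simp add: root_Y_def)
qed

text \<open>The root again meets the condition under which the iteration converges, so roots can be
  taken repeatedly.\<close>

lemma root_pos_bound: "pos_bound H 1 usqrt"
proof -
  have "norm (x - usqrt x) \<le> norm x" if x: "x \<in> carrier H" for x
  proof (rule LIMSEQ_le_const2[OF tendsto_norm[OF root_Y_tendsto[OF x]]], intro exI allI impI)
    fix n
    show "norm (root_Y n x) \<le> norm x"
      using root_Y_bound[OF x, of n] root_val_bounds[of n] mult_right_mono[of "root_val n" 1 "norm x"]
      by simp
  qed
  then show ?thesis using root_adj by (simp add: pos_bound_def)
qed

text \<open>The iterates are contractions, so the limit passes through
  \<open>root_Y n (root_Y n x)\<close>. Hence \<open>1 - usqrt\<close> is a fixed point of the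
  iteration, and solving the fixed point equation gives the square.\<close>

lemma root_square:
  assumes x: "x \<in> carrier H"
  shows "usqrt (usqrt x) = Q x"
proof -
  note rc = adjoints_carrier(1)[OF root_adj]
  let ?y = "x - usqrt x"
  have y: "?y \<in> carrier H" using x rc by (simp add: closed)
  have "(\<lambda>n. root_Y n (root_Y n x - ?y)) \<longlonglongrightarrow> 0"
  proof (rule Lim_null_comparison)
    show "(\<lambda>n. norm (root_Y n x - ?y)) \<longlonglongrightarrow> 0"
      by (rule tendsto_norm_zero[OF LIM_zero[OF root_Y_tendsto[OF x]]])
    have "norm (root_Y n z) \<le> norm z" if "z \<in> carrier H" for n z
      using root_Y_bound[OF that, of n] root_val_bounds[of n] mult_right_mono[of "root_val n" 1 "norm z"]
      by simp
    then show "\<forall>\<^sub>F n in sequentially. norm (root_Y n (root_Y n x - ?y)) \<le> norm (root_Y n x - ?y)"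
      using x y by (simp add: closed root_Y_carrier)
  qed
  from tendsto_add[OF this root_Y_tendsto[OF y]]
  have "(\<lambda>n. root_Y n (root_Y n x)) \<longlonglongrightarrow> ?y - usqrt ?y"
    using x y by (simp add: root_Y_diff root_Y_carrier)
  then have "(\<lambda>n. (1/2) *\<^sub>R (x - Q x + root_Y n (root_Y n x))) \<longlonglongrightarrow> (1/2) *\<^sub>R (x - Q x + (?y - usqrt ?y))"
    by (intro tendsto_intros)
  then have "(\<lambda>n. root_Y (Suc n) x) \<longlonglongrightarrow> (1/2) *\<^sub>R (x - Q x + (?y - usqrt ?y))"
    by (simp add: root_Y_Suc[OF x])
  then have "?y = (1/2) *\<^sub>R (x - Q x + (?y - usqrt ?y))"
    using LIMSEQ_unique LIMSEQ_Suc[OF root_Y_tendsto[OF x]] by blast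
  then have "2 *\<^sub>R ?y = x - Q x + (?y - usqrt ?y)"
    by (metis scaleR_half_double scaleR_2 scaleR_right_distrib)
  then show ?thesis
    using x rc by (simp add: self.adjoints_linear[OF root_adj] scaleR_2 algebra_simps)
qed

end

end

context hilbert_pair
begin

lemma usqrt_intertwine:
  assumes Q: "pos_bound H 1 Q" and Q': "pos_bound K 1 Q'" and Z: "adjoints H K Z Z'"
    and ZQ: "\<And>x. x \<in> carrier H \<Longrightarrow> Z (Q x) = Q' (Z x)" and x: "x \<in> carrier H"
  shows "Z (H.usqrt Q x) = K.usqrt Q' (Z x)"
proof (rule LIMSEQ_unique)
  note c = H.quot_carrier(1,3)[OF Q]
  show "(\<lambda>n. Z (Q (root_quot Q n x))) \<longlonglongrightarrow> Z (H.usqrt Q x)"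
    using H.root_tendsto[OF Q x] x c adjoints_carrier[OF H.root_adj[OF Q]]
    by (intro adjoints_tendsto[OF Z]) auto
  have "Z (Q (root_quot Q n x)) = Q' (root_quot Q' n (Z x))" for n
    using x c by (simp add: ZQ root_quot_intertwine[OF H.Q_adj[OF Q] K.Q_adj[OF Q'] Z ZQ])
  then show "(\<lambda>n. Z (Q (root_quot Q n x))) \<longlonglongrightarrow> K.usqrt Q' (Z x)"
    using K.root_tendsto[OF Q', of "Z x"] adjoints_carrier[OF Z] x by simp
qed

end

section \<open>Scaling, sums and squares of positive operators\<close>

definition scaled_quot :: "real \<Rightarrow> ('x::real_vector \<Rightarrow> 'x) \<Rightarrow> nat \<Rightarrow> 'x \<Rightarrow> 'x" where
  "scaled_quot t Q n x = (1 / sqrt t) *\<^sub>R root_quot (\<lambda>x. (1 / t) *\<^sub>R Q x) n x"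

text \<open>Lets two operators share one bound, so that their roots are limits of the same
  polynomials, as \<open>positive_intertwine\<close> needs.\<close>

lemma pos_bound_mono:
  assumes "pos_bound H t A" "t \<le> s"
  shows "pos_bound H s A"
proof -
  have "norm (s *\<^sub>R x - A x) \<le> s * norm x" if x: "x \<in> carrier H" for x
  proof -
    have "norm (s *\<^sub>R x - A x) = norm ((s - t) *\<^sub>R x + (t *\<^sub>R x - A x))" by (simp add: algebra_simps)
    also have "\<dots> \<le> (s - t) * norm x + t * norm x"
      using assms x by (intro norm_triangle_le add_mono) (auto simp: pos_bound_def)
    finally show ?thesis by (simp add: algebra_simps)
  qed
  then show ?thesis using assms by (auto simp: pos_bound_def)
qed

context hilbert_module
begin

lemma pos_bound_scale:
  assumes Q: "pos_bound H t Q" and s: "s > 0"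
  shows "pos_bound H (s * t) (\<lambda>x. s *\<^sub>R Q x)"
proof -
  have "adjoints H H (\<lambda>x. s *\<^sub>R Q x + 0 *\<^sub>R Q x) (\<lambda>x. s *\<^sub>R Q x + 0 *\<^sub>R Q x)"
    using Q by (intro self.adjoints_comb) (auto simp: pos_bound_def)
  moreover have "norm ((s * t) *\<^sub>R x - s *\<^sub>R Q x) \<le> s * t * norm x" if x: "x \<in> carrier H" for x
  proof -
    have "norm ((s * t) *\<^sub>R x - s *\<^sub>R Q x) = norm (s *\<^sub>R (t *\<^sub>R x - Q x))"
      by (simp add: algebra_simps)
    also have "\<dots> \<le> s * (t * norm x)"
      using Q x s by (simp add: pos_bound_def)
    finally show ?thesis by simp
  qed
  ultimately show ?thesis using Q s by (simp add: pos_bound_def)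
qed

lemma positive_cong:
  assumes "positive_op H A" "\<And>x. x \<in> carrier H \<Longrightarrow> B x = A x"
  shows "positive_op H B"
proof -
  obtain t where t: "pos_bound H t A" using assms(1) unfolding positive_op_def by blast
  then have "adjoints H H B B"
    by (simp add: adjoints_cong[of H H A A] pos_bound_def assms(2))
  then show ?thesis
    using t by (intro positiveI[of H t]) (simp add: pos_bound_def assms(2))
qed

lemma positive_add:
  assumes "positive_op H A" "positive_op H B"
  shows "positive_op H (\<lambda>x. A x + B x)"
proof -
  obtain s t where st: "pos_bound H s A" "pos_bound H t B"
    using assms by (auto simp: positive_op_def)
  have "norm ((s + t) *\<^sub>R x - (A x + B x)) \<le> (s + t) * norm x" if x: "x \<in> carrier H" for x
  proof -
    have "norm ((s + t) *\<^sub>R x - (A x + B x)) = norm ((s *\<^sub>R x - A x) + (t *\<^sub>R x - B x))"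
      by (simp add: algebra_simps)
    also have "\<dots> \<le> s * norm x + t * norm x"
      using st x by (intro norm_triangle_le add_mono) (auto simp: pos_bound_def)
    finally show ?thesis by (simp add: algebra_simps)
  qed
  moreover have "adjoints H H (\<lambda>x. A x + B x) (\<lambda>x. A x + B x)"
    using self.adjoints_comb[of A A B B 1 1] assms by (simp add: positive_adjoints)
  ultimately show ?thesis
    using st by (intro positiveI[of _ "s + t"]) (auto simp: pos_bound_def)
qed

lemma positive_scaleR:
  assumes "positive_op H A" "s > 0"
  shows "positive_op H (\<lambda>x. s *\<^sub>R A x)"
  using assms pos_bound_scale unfolding positive_op_def by blast

text \<open>If \<open>a\<close> and \<open>b\<close> are self-adjoint and commute, then \<open>a \<plusminus> i b\<close> multiplies the inner product by
  \<open>a\<^sup>2 + b\<^sup>2\<close>. This replaces all use of the spectrum.\<close>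

lemma hinner_commuting:
  assumes a: "adjoints H H a a" and b: "adjoints H H b b" and y: "y \<in> carrier H"
    and ab: "a (b y) = b (a y)"
  shows "hinner H (a y + \<i> *\<^sub>C b y) (a y + \<i> *\<^sub>C b y) = hinner H y (a (a y) + b (b y))"
    and "hinner H (a y - \<i> *\<^sub>C b y) (a y - \<i> *\<^sub>C b y) = hinner H y (a (a y) + b (b y))"
  using y ab adjoints_carrier[OF a] adjoints_carrier[OF b]
  by (simp_all add: closed hinner_linear adjoints_hinner[OF a] adjoints_hinner[OF b]
      scaleC_add_right scaleC_diff_right)

text \<open>Both \<open>a y + i b y\<close> and \<open>a y - i b y\<close> have inner square 0. This
  takes the place of the fact that a sum of two positive elements vanishes only if both do.\<close>

lemma commuting_squares_zero:
  assumes a: "adjoints H H a a" and b: "adjoints H H b b" and y: "y \<in> carrier H"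
    and ab: "a (b y) = b (a y)" and 0: "a (a y) + b (b y) = 0"
  shows "a y = 0" "b y = 0"
proof -
  note c = adjoints_carrier[OF a] adjoints_carrier[OF b]
  have "hinner H (a y + \<i> *\<^sub>C b y) (a y + \<i> *\<^sub>C b y) = 0"
    "hinner H (a y - \<i> *\<^sub>C b y) (a y - \<i> *\<^sub>C b y) = 0"
    unfolding hinner_commuting[OF assms(1-4)] 0 by (simp_all add: y hinner_zero_right)
  then have z: "a y + \<i> *\<^sub>C b y = 0" "a y - \<i> *\<^sub>C b y = 0"
    using hinner_definite[of "a y + \<i> *\<^sub>C b y"] hinner_definite[of "a y - \<i> *\<^sub>C b y"]
    by (simp_all only: closed c y)
  have "2 *\<^sub>R a y = (a y + \<i> *\<^sub>C b y) + (a y - \<i> *\<^sub>C b y)" by (simp add: scaleR_2)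
  then show "a y = 0" unfolding z by simp
  then have "\<i> *\<^sub>C \<i> *\<^sub>C b y = 0" using z by simp
  then show "b y = 0" by (simp only: scaleC_i_i) simp
qed

text \<open>\<open>a + i b\<close> and \<open>a - i b\<close> preserve the norm of \<open>y\<close>,
  as unitaries would, and their difference is \<open>2 i b\<close>.\<close>

lemma commuting_squares_contract:
  assumes a: "adjoints H H a a" and b: "adjoints H H b b" and y: "y \<in> carrier H"
    and ab: "a (b y) = b (a y)" and 1: "a (a y) + b (b y) = y"
  shows "norm (b y) \<le> norm y"
proof -
  note c = adjoints_carrier[OF a] adjoints_carrier[OF b]
  have "(norm (a y + \<i> *\<^sub>C b y))\<^sup>2 = (norm y)\<^sup>2" "(norm (a y - \<i> *\<^sub>C b y))\<^sup>2 = (norm y)\<^sup>2"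
    using hinner_commuting[OF assms(1-4)] y c by (simp_all add: norm_power2 closed 1)
  then have n: "norm (a y + \<i> *\<^sub>C b y) = norm y" "norm (a y - \<i> *\<^sub>C b y) = norm y"
    by (simp_all add: power2_eq_iff_nonneg)
  have "2 * norm (b y) = norm ((a y + \<i> *\<^sub>C b y) - (a y - \<i> *\<^sub>C b y))"
    using norm_scaleC[of \<i> "b y"] by (simp flip: scaleR_2)
  also have "\<dots> \<le> norm y + norm y"
    by (rule order_trans[OF norm_triangle_ineq4]) (simp add: n)
  finally show ?thesis by simp
qed

text \<open>With the contraction \<open>D = A / c\<close>, the operator \<open>Q = 1 - D D\<close>
  has a root commuting with \<open>D\<close>, and \<open>D D + Q = 1\<close> makes that root a
  contraction. Hence \<open>Q\<close> is a contraction, which is the claim after scaling by the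
  square of \<open>c\<close>.\<close>

lemma square_pos_bound:
  assumes A: "adjoints H H A A" and c: "c > 0" "\<And>x. x \<in> carrier H \<Longrightarrow> norm (A x) \<le> c * norm x"
  shows "pos_bound H (c\<^sup>2) (\<lambda>x. A (A x))"
proof -
  define D where "D x = (1 / c) *\<^sub>R A x" for x
  have "adjoints H H (\<lambda>x. (1 / c) *\<^sub>R A x + 0 *\<^sub>R A x) (\<lambda>x. (1 / c) *\<^sub>R A x + 0 *\<^sub>R A x)"
    by (intro self.adjoints_comb A)
  then have D: "adjoints H H D D" by (simp add: D_def[abs_def])
  note Dc = adjoints_carrier(1)[OF D]
  have Dn: "norm (D x) \<le> norm x" if "x \<in> carrier H" for x
    using c that by (simp add: D_def field_simps)
  define Q where "Q x = x - D (D x)" for x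
  have Q: "pos_bound H 1 Q"
    using self.adjoints_comb[OF adjoints_id adjoints_compose[OF D D], of 1 "-1"]
      Dn order_trans[OF Dn[OF Dc] Dn]
    by (simp add: pos_bound_def Q_def[abs_def])
  have DB: "D (usqrt Q x) = usqrt Q (D x)" if "x \<in> carrier H" for x
    using Dc that by (intro self.usqrt_intertwine[OF Q Q D]) (auto simp: Q_def self.adjoints_linear[OF D])
  note B = root_adj[OF Q]
  have n: "norm (usqrt Q x) \<le> norm x" if x: "x \<in> carrier H" for x
    using x by (intro commuting_squares_contract[OF D B]) (simp_all add: DB root_square[OF Q] Q_def)
  have *: "norm (usqrt Q (usqrt Q x)) \<le> norm x" if x: "x \<in> carrier H" for x
    by (rule order_trans[OF n[OF adjoints_carrier(1)[OF B x]] n[OF x]])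
  have "norm (c\<^sup>2 *\<^sub>R x - A (A x)) \<le> c\<^sup>2 * norm x" if x: "x \<in> carrier H" for x
  proof -
    have "A (A x) = c\<^sup>2 *\<^sub>R D (D x)"
      using x c adjoints_carrier(1)[OF A]
      by (simp add: D_def self.adjoints_linear[OF A] power2_eq_square)
    then have "c\<^sup>2 *\<^sub>R x - A (A x) = c\<^sup>2 *\<^sub>R usqrt Q (usqrt Q x)"
      using x by (simp add: root_square[OF Q] Q_def algebra_simps)
    then show ?thesis
      using *[OF x] by (simp add: mult_left_mono)
  qed
  then show ?thesis
    using c adjoints_compose[OF A A] by (simp add: pos_bound_def)
qed

lemma positive_square:
  assumes A: "adjoints H H A A"
  shows "positive_op H (\<lambda>x. A (A x))"
  by (rule self.adjoints_bounded[OF A]) (use square_pos_bound[OF A] positiveI in blast)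

context
  fixes t Q
  assumes Q: "pos_bound H t Q"
begin

lemma t_pos: "t > 0" and Q_selfadj: "adjoints H H Q Q"
  using Q by (auto simp: pos_bound_def)

definition "op_root x = sqrt t *\<^sub>R usqrt (\<lambda>x. (1 / t) *\<^sub>R Q x) x"

lemma unit_bound: "pos_bound H 1 (\<lambda>x. (1 / t) *\<^sub>R Q x)"
  using pos_bound_scale[OF Q, of "1 / t"] t_pos by simp

lemma quot_selfadj: "adjoints H H (scaled_quot t Q n) (scaled_quot t Q n)"
  using self.adjoints_comb[OF quot_adj[OF unit_bound, of n] quot_adj[OF unit_bound, of n],
      where a = "1 / sqrt t" and b = 0]
  by (simp add: scaled_quot_def[abs_def])

lemma op_root_err:
  assumes x: "x \<in> carrier H"
  shows "norm (Q (scaled_quot t Q n x) - op_root x) \<le> sqrt t * (2 * (1 - root_val n)) * norm x"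
proof -
  let ?Q = "\<lambda>x. (1 / t) *\<^sub>R Q x"
  have "Q (scaled_quot t Q n x) = sqrt t *\<^sub>R ?Q (root_quot ?Q n x)"
  proof -
    \<comment> \<open>The factor \<open>1 / sqrt t\<close> in \<open>scaled_quot\<close> is what
      remains when the root of \<open>Q / t\<close> is rescaled by \<open>sqrt t\<close>.\<close>
    have "1 / sqrt t = sqrt t * (1 / t)"
      using t_pos real_div_sqrt[of t] by (simp add: field_simps)
    then show ?thesis
      using x quot_carrier[OF unit_bound] by (simp add: scaled_quot_def self.adjoints_linear[OF Q_selfadj])
  qed
  then have "norm (Q (scaled_quot t Q n x) - op_root x) = norm (sqrt t *\<^sub>R (?Q (root_quot ?Q n x) - usqrt ?Q x))"
    by (simp add: op_root_def scaleR_diff_right)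
  also have "\<dots> = sqrt t * norm (?Q (root_quot ?Q n x) - usqrt ?Q x)"
    using t_pos by simp
  also have "\<dots> \<le> sqrt t * (2 * (1 - root_val n) * norm x)"
    using root_err[OF unit_bound x, of n] t_pos by (intro mult_left_mono) auto
  finally show ?thesis by (simp add: mult.assoc)
qed

lemma op_root_pos_bound: "pos_bound H (sqrt t) op_root"
  using pos_bound_scale[OF root_pos_bound[OF unit_bound], of "sqrt t"] t_pos
  by (simp add: op_root_def[abs_def])

lemma op_root_square:
  assumes x: "x \<in> carrier H"
  shows "op_root (op_root x) = Q x"
  using x t_pos adjoints_carrier(1)[OF root_adj[OF unit_bound]]
  by (simp add: op_root_def self.adjoints_linear[OF root_adj[OF unit_bound]] root_square[OF unit_bound])

end

end

section \<open>Intertwining and uniqueness of positive roots\<close>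

context hilbert_pair
begin

context
  fixes t Q Q' Z Z'
  assumes Q: "pos_bound H t Q" and Q': "pos_bound K t Q'" and Z: "adjoints H K Z Z'"
    and ZQ: "\<And>x. x \<in> carrier H \<Longrightarrow> Z (Q x) = Q' (Z x)"
begin

lemma op_root_intertwine: "x \<in> carrier H \<Longrightarrow> Z (H.op_root t Q x) = K.op_root t Q' (Z x)"
  using adjoints_carrier[OF H.root_adj[OF H.unit_bound[OF Q]]] adjoints_carrier[OF H.Q_selfadj[OF Q]]
  by (simp add: H.op_root_def[OF Q] K.op_root_def[OF Q'] adjoints_linear[OF Z] ZQ
      usqrt_intertwine[OF H.unit_bound[OF Q] K.unit_bound[OF Q'] Z])

end

end

context hilbert_module
begin

text \<open>Let \<open>B\<close> be the constructed root and \<open>y = R x - B x\<close>. As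
  \<open>R\<close> and \<open>B\<close> commute, \<open>(R + B) y = 0\<close>. Writing
  \<open>R\<close> and \<open>B\<close> as squares of commuting \<open>P\<close> and
  \<open>C\<close> turns this into a vanishing sum of squares, so \<open>R y = B y = 0\<close>, and
  \<open>y\<close> is orthogonal to itself.\<close>

lemma positive_eq_op_root:
  assumes Q: "pos_bound H t Q" and R: "positive_op H R"
    and RQ: "\<And>x. x \<in> carrier H \<Longrightarrow> R (R x) = Q x" and x: "x \<in> carrier H"
  shows "R x = op_root t Q x"
proof -
  define B where "B = op_root t Q"
  have pB: "pos_bound H (sqrt t) B" and BB: "\<And>x. x \<in> carrier H \<Longrightarrow> B (B x) = Q x"
    using op_root_pos_bound[OF Q] op_root_square[OF Q] by (simp_all add: B_def)
  obtain s where s: "pos_bound H s R" using R by (auto simp: positive_op_def)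
  define P where "P = op_root s R"
  define C where "C = op_root (sqrt t) B"
  have P: "adjoints H H P P" and PP: "\<And>x. x \<in> carrier H \<Longrightarrow> P (P x) = R x"
    using op_root_pos_bound[OF s] op_root_square[OF s] by (simp_all add: P_def pos_bound_def)
  have C: "adjoints H H C C" and CC: "\<And>x. x \<in> carrier H \<Longrightarrow> C (C x) = B x"
    using op_root_pos_bound[OF pB] op_root_square[OF pB] by (simp_all add: C_def pos_bound_def)
  note Ra = Q_selfadj[OF s] and Ba = Q_selfadj[OF pB]
  note c = adjoints_carrier(1)[OF Ra] adjoints_carrier(1)[OF Ba] adjoints_carrier(1)[OF P]
    adjoints_carrier(1)[OF C]
  have RB: "R (B x) = B (R x)" if "x \<in> carrier H" for x
    unfolding B_def by (rule self.op_root_intertwine[OF Q Q Ra _ that]) (simp add: RQ[symmetric] c)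
  have RC: "R (C x) = C (R x)" if "x \<in> carrier H" for x
    unfolding C_def by (rule self.op_root_intertwine[OF pB pB Ra _ that]) (simp add: RB)
  have CP: "C (P x) = P (C x)" if "x \<in> carrier H" for x
    unfolding P_def by (rule self.op_root_intertwine[OF s s C _ that]) (simp add: RC)
  define y where "y = R x - B x"
  have y: "y \<in> carrier H" using x c by (simp add: y_def closed)
  have "P (P y) + C (C y) = 0"
    using x y c by (simp add: PP CC) (simp add: y_def self.adjoints_linear[OF Ra]
        self.adjoints_linear[OF Ba] RB RQ BB)
  then have "P y = 0" "C y = 0"
    using commuting_squares_zero[OF P C y] CP[OF y, symmetric] by blast+
  then have "R y = 0" "B y = 0"
    using PP[OF y] CC[OF y] self.adjoints_zero[OF P] self.adjoints_zero[OF C] by auto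
  then have "hinner H y y = 0"
    using x y c by (subst (1) y_def)
      (simp add: hinner_diff_left adjoints_hinner[OF Ra] adjoints_hinner[OF Ba])
  then show ?thesis using hinner_definite[OF y] by (simp add: y_def B_def)
qed

lemma positive_root_unique:
  assumes "positive_op H B" "positive_op H R" "\<And>x. x \<in> carrier H \<Longrightarrow> B (B x) = R (R x)" "x \<in> carrier H"
  shows "B x = R x"
proof -
  obtain t where t: "pos_bound H t (\<lambda>x. R (R x))"
    using positive_square[OF positive_adjoints[OF assms(2)]] by (auto simp: positive_op_def)
  show ?thesis
    using positive_eq_op_root[OF t assms(1,3,4)] positive_eq_op_root[OF t assms(2) refl assms(4)]
    by simp
qed

end

context hilbert_pair
begin

text \<open>By uniqueness \<open>B\<close> and \<open>B'\<close> are the constructed roots of their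
  squares, and \<open>Z\<close> intertwines polynomials in the squares.\<close>

lemma positive_intertwine:
  assumes B: "positive_op H B" and B': "positive_op K B'" and Z: "adjoints H K Z Z'"
    and eq: "\<And>x. x \<in> carrier H \<Longrightarrow> Z (B (B x)) = B' (B' (Z x))" and x: "x \<in> carrier H"
  shows "Z (B x) = B' (Z x)"
proof -
  obtain s s' where "pos_bound H s (\<lambda>x. B (B x))" "pos_bound K s' (\<lambda>x. B' (B' x))"
    using H.positive_square[OF positive_adjoints[OF B]] K.positive_square[OF positive_adjoints[OF B']]
    by (auto simp: positive_op_def)
  then have s: "pos_bound H (max s s') (\<lambda>x. B (B x))" "pos_bound K (max s s') (\<lambda>x. B' (B' x))"
    by (auto elim: pos_bound_mono)
  show ?thesis
    using op_root_intertwine[OF s Z eq x] H.positive_eq_op_root[OF s(1) B _ x]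
      K.positive_eq_op_root[OF s(2) B', of "Z x"] adjoints_carrier(1)[OF Z x] by simp
qed

end

section \<open>Positivity of \<open>S\<^sup>* S\<close>\<close>

context hilbert_module
begin

text \<open>\<open>N\<close> is the negative part of \<open>P\<close>, and \<open>g\<close> is its power \<open>3/2\<close>.\<close>

lemma negative_part:
  assumes P: "adjoints H H P P"
  obtains N g where "adjoints H H N N" "adjoints H H g g"
    "\<And>x. x \<in> carrier H \<Longrightarrow> N (P (N x)) = - g (g x)"
    "(\<And>x. x \<in> carrier H \<Longrightarrow> g x = 0) \<Longrightarrow> positive_op H P"
proof -
  obtain t where t: "pos_bound H t (\<lambda>x. P (P x))"
    using positive_square[OF P] by (auto simp: positive_op_def)
  define C where "C = op_root t (\<lambda>x. P (P x))"
  have pC: "pos_bound H (sqrt t) C" and CC: "\<And>x. x \<in> carrier H \<Longrightarrow> C (C x) = P (P x)"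
    using op_root_pos_bound[OF t] op_root_square[OF t] by (simp_all add: C_def)
  have Ca: "adjoints H H C C" using pC by (simp add: pos_bound_def)
  note c = adjoints_carrier(1)[OF P] adjoints_carrier(1)[OF Ca]
  have PC: "P (C x) = C (P x)" if "x \<in> carrier H" for x
    unfolding C_def by (rule self.op_root_intertwine[OF t t P _ that]) simp
  \<comment> \<open>Since \<open>C\<close> is \<open>|P|\<close>, the positive part
    \<open>(C + P) / 2\<close> annihilates the range of \<open>N\<close>; this is the equation
    \<open>PN\<close> below.\<close>
  define N where "N x = (1/2) *\<^sub>R (C x - P x)" for x
  have N: "adjoints H H N N"
    using self.adjoints_comb[OF Ca P, of "1/2" "-1/2"] by (simp add: N_def[abs_def] scaleR_diff_right)
  define G where "G = op_root (sqrt t) C"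
  have pG: "pos_bound H (sqrt (sqrt t)) G" and GG: "\<And>x. x \<in> carrier H \<Longrightarrow> G (G x) = C x"
    using op_root_pos_bound[OF pC] op_root_square[OF pC] by (simp_all add: G_def)
  have G: "adjoints H H G G" using pG by (simp add: pos_bound_def)
  note c = c adjoints_carrier(1)[OF N] adjoints_carrier(1)[OF G]
  have NC: "N (C x) = C (N x)" if "x \<in> carrier H" for x
    using that c by (simp add: N_def self.adjoints_linear[OF Ca] closed PC)
  have NG: "N (G x) = G (N x)" if "x \<in> carrier H" for x
    unfolding G_def by (rule self.op_root_intertwine[OF pC pC N _ that]) (simp add: NC)
  have PN: "P (N x) = - C (N x)" if "x \<in> carrier H" for x
    using that c by (simp add: N_def self.adjoints_linear[OF Ca] self.adjoints_linear[OF P] closed PC CC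
        algebra_simps)
  have NN: "N (N x) = C (N x)" if x: "x \<in> carrier H" for x
    by (subst N_def) (simp add: PN[OF x])
  \<comment> \<open>\<open>C\<close> agrees with \<open>N\<close> on the range of \<open>N\<close>,
    so multiplying \<open>N\<close> by the root of \<open>C\<close> gives the power 3/2.\<close>
  define g where "g x = G (N x)" for x
  have gg: "g (g x) = C (N (N x))" if "x \<in> carrier H" for x
    using that c by (simp add: g_def NG GG)
  show thesis
  proof
    show "adjoints H H N N" by (rule N)
    show "adjoints H H g g"
      by (rule adjoints_cong[OF adjoints_compose[OF N G]]) (simp_all add: g_def NG)
    show "N (P (N x)) = - g (g x)" if "x \<in> carrier H" for x
      using that c by (simp add: PN gg self.adjoints_linear[OF N] NC)
    show "positive_op H P" if "\<And>x. x \<in> carrier H \<Longrightarrow> g x = 0"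
    proof -
      have "N x = 0" if x: "x \<in> carrier H" for x
      proof -
        have "C (N (N x)) = 0"
          using x gg[OF x] that \<open>\<And>x. x \<in> carrier H \<Longrightarrow> g x = 0\<close> zero_closed by simp
        then have NNN: "N (N (N x)) = 0" using x c by (simp add: NN NC)
        then have "hinner H (N (N x)) (N (N x)) = 0"
          using x c by (simp add: adjoints_hinner[OF N] hinner_zero_right self.adjoints_zero[OF N])
        then have "N (N x) = 0" using x c by (intro hinner_definite) auto
        then have "hinner H (N x) (N x) = 0"
          using x c by (simp add: adjoints_hinner[OF N] hinner_zero_right)
        then show ?thesis using x c by (intro hinner_definite) auto
      qed
      then have "P x = C x" if "x \<in> carrier H" for x
        using that by (simp add: N_def)
      then show ?thesis using positive_cong[OF positiveI[OF pC]] by blast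
    qed
  qed
qed

end

section \<open>Positivity of \<open>star b * b\<close> in the algebra\<close>

definition alg_module :: "('a::cstar_algebra, 'a) hmodule" where
  "alg_module = \<lparr>carrier = UNIV, hinner = (\<lambda>a b. star a * b), act = (*)\<rparr>"

lemma hilbert_module_alg: "hilbert_module (alg_module :: ('a::cstar_algebra, 'a) hmodule)"
  by unfold_locales
    (auto simp: alg_module_def distrib_left distrib_right mult.assoc mult_scaleC_left
      mult_scaleC_right star_mult star_star star_mult_self_eq_0 cstar_identity cstar_pos_def
      complete_UNIV)

text \<open>Represents elements as operators on the algebra itself, where the identity exists even
  if the algebra has no unit, so that the root construction applies.\<close>

lemma adjoints_left_mult: "adjoints alg_module alg_module ((*) b) ((*) (star b))"
  by (simp add: adjoints_def alg_module_def star_mult mult.assoc)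

text \<open>The Kelley--Vaught argument. If the negative part did not vanish, there would be \<open>z \<noteq> 0\<close> with
  \<open>z\<^sup>* z = - g\<^sup>2\<close>. Then \<open>W = z z\<^sup>*\<close> is positive, because \<open>z z\<^sup>* + z\<^sup>* z\<close> is a sum of squares, and
  \<open>z g\<^sup>2 = - W z\<close>. Hence \<open>z g\<^sup>4 = W\<^sup>2 z\<close>, and taking square roots gives \<open>z g\<^sup>2 = W z\<close>.\<close>

lemma positive_left_mult:
  fixes b :: "'a::cstar_algebra"
  shows "positive_op alg_module (\<lambda>x. star b * (b * x))"
proof -
  interpret A: hilbert_module "alg_module :: ('a, 'a) hmodule" by (rule hilbert_module_alg)
  have U [simp]: "x \<in> carrier alg_module" for x :: 'a by (simp add: alg_module_def)
  let ?A = "alg_module :: ('a, 'a) hmodule"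
  note L = adjoints_left_mult[of b] A.self.adjoints_sym[OF adjoints_left_mult[of b]]
  define P where "P x = star b * (b * x)" for x
  have P: "adjoints ?A ?A P P"
    unfolding P_def[abs_def] by (rule adjoints_compose[OF L])
  obtain N g where N: "adjoints ?A ?A N N" and g: "adjoints ?A ?A g g"
    and NPN: "\<And>x. N (P (N x)) = - g (g x)" and pos: "(\<And>x. g x = 0) \<Longrightarrow> positive_op ?A P"
    using A.negative_part[OF P] by (metis U)
  define z z' where "z x = b * N x" and "z' x = N (star b * x)" for x
  have z: "adjoints ?A ?A z z'"
    unfolding z_def[abs_def] z'_def[abs_def] by (rule adjoints_compose[OF N L(1)])
  note z' = A.self.adjoints_sym[OF z]
  have z'z: "z' (z x) = - g (g x)" for x
    using NPN[of x] by (simp add: z_def z'_def P_def)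
  define W where "W x = z (z' x)" for x
  \<comment> \<open>These are \<open>2 Re z\<close> and \<open>- 2 Im z\<close>, so
    \<open>h h + k k\<close> is twice \<open>z z' + z' z\<close>.\<close>
  define h k where "h x = z x + z' x" and "k x = \<i> *\<^sub>C (z x - z' x)" for x
  have h: "adjoints ?A ?A h h"
    using A.self.adjoints_comb[OF z z', of 1 1] by (simp add: h_def[abs_def] add.commute)
  have k: "adjoints ?A ?A k k"
    using A.self.adjoints_scale[OF A.self.adjoints_comb[OF z z', of 1 "-1"], of \<i>]
    by (rule adjoints_cong) (simp_all add: k_def scaleC_diff_right)
  note lin = A.self.adjoints_linear[OF z] A.self.adjoints_linear[OF z']
  have "h (h x) + k (k x) = 2 *\<^sub>R (W x + z' (z x))" for x
    by (simp add: h_def k_def W_def lin scaleC_diff_right scaleC_add_right scaleR_2)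
  then have W_eq: "W x = (1/2) *\<^sub>R (h (h x) + k (k x)) + g (g x)" for x
    by (simp add: z'z)
  have pg: "positive_op ?A (\<lambda>x. g (g x))" by (rule A.positive_square[OF g])
  have pW: "positive_op ?A W"
    unfolding W_eq[abs_def]
    by (intro A.positive_add A.positive_scaleR A.positive_square h k g) simp
  have Wz: "W (z x) = - z (g (g x))" for x
    by (simp add: W_def z'z lin)
  have "z (g (g x)) = W (z x)" for x
    by (rule A.self.positive_intertwine[OF pg pW z _ U])
      (simp add: Wz A.self.adjoints_minus[OF positive_adjoints[OF pW] U])
  then have "z (g (g x)) = - z (g (g x))" for x
    using Wz by simp
  then have "2 *\<^sub>R z (g (g x)) = 0" for x
    by (metis scaleR_2 add.right_inverse)
  then have "z (g (g x)) = 0" for x by simp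
  then have g4: "g (g (g (g x))) = 0" for x
    using z'z[of "g (g x)"] by (simp add: A.self.adjoints_zero[OF z'])
  have "g x = 0" for x
  proof -
    have "hinner ?A (g (g x)) (g (g x)) = hinner ?A x (g (g (g (g x))))"
      by (simp add: adjoints_hinner[OF g])
    then have "g (g x) = 0" using A.hinner_definite[OF U, of "g (g x)"] by (simp add: g4 A.hinner_zero_right)
    moreover have "hinner ?A (g x) (g x) = hinner ?A x (g (g x))"
      by (simp add: adjoints_hinner[OF g])
    ultimately show ?thesis using A.hinner_definite[OF U, of "g x"] by (simp add: A.hinner_zero_right)
  qed
  then show ?thesis using pos by (simp add: P_def[abs_def])
qed

text \<open>As left multiplications the two summands are negatives of each other and therefore
  commute, as do their roots, so \<open>commuting_squares_zero\<close> applies. Evaluation at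
  \<open>star c * c\<close> and the C*-identity lead back to the algebra.\<close>

lemma star_mult_sum_eq_0:
  fixes b c :: "'a::cstar_algebra"
  assumes "star b * b + star c * c = 0"
  shows "c = 0"
proof -
  interpret A: hilbert_module "alg_module :: ('a, 'a) hmodule" by (rule hilbert_module_alg)
  have U [simp]: "x \<in> carrier alg_module" for x :: 'a by (simp add: alg_module_def)
  define B C where "B x = star b * (b * x)" and "C x = star c * (c * x)" for x
  obtain s t where s: "pos_bound alg_module s C" and t: "pos_bound alg_module t B"
    using positive_left_mult[of b] positive_left_mult[of c]
    by (auto simp: positive_op_def B_def[abs_def] C_def[abs_def])
  have BC: "B x + C x = 0" for x
    using assms distrib_right[of "star b * b" "star c * c" x] by (simp add: B_def C_def mult.assoc)
  define \<rho> \<sigma> where "\<rho> = A.op_root s C" and "\<sigma> = A.op_root t B"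
  note Ca = A.Q_selfadj[OF s]
  have \<rho>: "adjoints alg_module alg_module \<rho> \<rho>" and \<rho>\<rho>: "\<rho> (\<rho> x) = C x" for x
    using A.op_root_pos_bound[OF s] A.op_root_square[OF s] by (simp_all add: \<rho>_def pos_bound_def)
  have \<sigma>: "adjoints alg_module alg_module \<sigma> \<sigma>" and \<sigma>\<sigma>: "\<sigma> (\<sigma> x) = B x" for x
    using A.op_root_pos_bound[OF t] A.op_root_square[OF t] by (simp_all add: \<sigma>_def pos_bound_def)
  have "B = (\<lambda>x. - C x)" using BC by (auto simp: eq_neg_iff_add_eq_0)
  then have "C (B x) = B (C x)" for x
    by (simp add: A.self.adjoints_minus[OF Ca U])
  then have "C (\<sigma> x) = \<sigma> (C x)" for x
    unfolding \<sigma>_def by (intro A.self.op_root_intertwine[OF t t Ca]) auto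
  then have "\<sigma> (\<rho> x) = \<rho> (\<sigma> x)" for x
    unfolding \<rho>_def by (intro A.self.op_root_intertwine[OF s s \<sigma>]) auto
  then have "\<rho> x = 0" for x
    using BC[of x] by (intro A.commuting_squares_zero(1)[OF \<rho> \<sigma> U]) (simp_all add: \<rho>\<rho> \<sigma>\<sigma> add.commute)
  then have "C x = 0" for x
    using \<rho>\<rho> by metis
  then have "star (star c * c) * (star c * c) = 0"
    by (simp add: C_def star_mult star_star mult.assoc)
  then show ?thesis by (simp add: star_mult_self_eq_0)
qed

context hilbert_pair
begin

text \<open>By \<open>N S' S N = - g g\<close> the inner squares of \<open>S (N x)\<close> and
  \<open>g x\<close> add up to 0. Both have the form \<open>star b * b\<close>, so
  \<open>g x\<close> vanishes, and with \<open>g\<close> the negative part.\<close>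

lemma positive_star_mult:
  assumes S: "adjoints H K S S'"
  shows "positive_op H (\<lambda>x. S' (S x))"
proof -
  let ?P = "\<lambda>x. S' (S x)"
  have P: "adjoints H H ?P ?P"
    by (rule adjoints_compose[OF S adjoints_sym[OF S]])
  obtain N g where N: "adjoints H H N N" and g: "adjoints H H g g"
    and NPN: "\<And>x. x \<in> carrier H \<Longrightarrow> N (?P (N x)) = - g (g x)"
    and pos: "(\<And>x. x \<in> carrier H \<Longrightarrow> g x = 0) \<Longrightarrow> positive_op H ?P"
    using H.negative_part[OF P] by blast
  note c = adjoints_carrier[OF S] adjoints_carrier[OF N] adjoints_carrier[OF g]
  have "g x = 0" if x: "x \<in> carrier H" for x
  proof -
    have "hinner K (S (N x)) (S (N x)) = hinner H x (N (?P (N x)))"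
      using x c by (simp add: adjoints_hinner[OF S] adjoints_hinner[OF N])
    also have "\<dots> = - hinner H (g x) (g x)"
      using x c by (simp add: NPN H.hinner_minus_right adjoints_hinner[OF g])
    finally have "hinner K (S (N x)) (S (N x)) + hinner H (g x) (g x) = 0" by simp
    moreover obtain b a where "hinner K (S (N x)) (S (N x)) = star b * b" "hinner H (g x) (g x) = star a * a"
      using H.hinner_pos[of "g x"] K.hinner_pos[of "S (N x)"] x c by (auto simp: cstar_pos_def)
    ultimately have "hinner H (g x) (g x) = 0"
      using star_mult_sum_eq_0[of b a] by simp
    then show ?thesis using x c by (intro H.hinner_definite) auto
  qed
  then show ?thesis by (rule pos)
qed

end

section \<open>The operators of the definitions\<close>

lemma is_adjoint_iff:
  "is_adjoint H K T S \<longleftrightarrow>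
     adjoints H K T S \<and> T \<in> extensional (carrier H) \<and> S \<in> extensional (carrier K)"
  by (auto simp: is_adjoint_def adjoints_def PiE_def)

context hilbert_pair
begin

lemma adj_eq:
  assumes "is_adjoint H K T S"
  shows "adj H K T = S"
  unfolding adj_def
proof (rule the_equality)
  show "is_adjoint H K T S" by (rule assms)
  fix S' assume "is_adjoint H K T S'"
  then show "S' = S"
    using assms adjoints_unique unfolding is_adjoint_iff by (intro extensionalityI) auto
qed

lemma is_adjoint_restrict:
  assumes "adjoints H K T S" "T \<in> extensional (carrier H)"
  shows "is_adjoint H K T (restrict S (carrier K))"
  using assms adjoints_cong[OF assms(1), of T "restrict S (carrier K)"] by (simp add: is_adjoint_iff)

lemma adjointableI:
  "adjoints H K T S \<Longrightarrow> T \<in> extensional (carrier H) \<Longrightarrow> T \<in> adjointable H K"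
  using is_adjoint_restrict by (auto simp: adjointable_def)

lemma adj_restrict:
  "adjoints H K T S \<Longrightarrow> T \<in> extensional (carrier H) \<Longrightarrow> adj H K T = restrict S (carrier K)"
  using is_adjoint_restrict adj_eq by blast

lemma is_adjoint_adj:
  assumes "T \<in> adjointable H K"
  shows "is_adjoint H K T (adj H K T)"
  using assms adj_eq by (auto simp: adjointable_def)

lemma adjoints_adj:
  assumes "T \<in> adjointable H K"
  shows "adjoints H K T (adj H K T)" "T \<in> extensional (carrier H)" "adj H K T \<in> extensional (carrier K)"
  using is_adjoint_adj[OF assms] by (auto simp: is_adjoint_iff)

end

context hilbert_module
begin

text \<open>One direction is \<open>positive_star_mult\<close>; the other takes the self-adjoint
  root for \<open>S\<close>.\<close>

lemma pos_op_iff: "pos_op H T \<longleftrightarrow> positive_op H T \<and> T \<in> extensional (carrier H)"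
proof
  assume "pos_op H T"
  then obtain S where S: "S \<in> adjointable H H" and T: "T = compose (carrier H) (adj H H S) S"
    by (auto simp: pos_op_def)
  show "positive_op H T \<and> T \<in> extensional (carrier H)"
    using positive_cong[OF self.positive_star_mult[OF self.adjoints_adj(1)[OF S]]]
    by (simp add: T compose_def)
next
  assume T: "positive_op H T \<and> T \<in> extensional (carrier H)"
  then obtain t where t: "pos_bound H t T" by (auto simp: positive_op_def)
  define S where "S = restrict (op_root t T) (carrier H)"
  note Ra = positive_adjoints[OF positiveI[OF op_root_pos_bound[OF t]]]
  have Sa: "adjoints H H S (op_root t T)"
    by (rule adjoints_cong[OF Ra]) (simp_all add: S_def)
  have Se: "S \<in> extensional (carrier H)" by (simp add: S_def)
  have adjS: "adj H H S = S"
    using self.adj_restrict[OF Sa Se] by (simp add: S_def)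
  have "T = compose (carrier H) (adj H H S) S"
  proof (rule extensionalityI[of _ "carrier H"])
    fix x assume "x \<in> carrier H"
    then show "T x = compose (carrier H) (adj H H S) S x"
      using adjoints_carrier(1)[OF Ra] by (simp add: adjS compose_def) (simp add: S_def op_root_square[OF t])
  qed (use T in simp_all)
  then show "pos_op H T"
    using self.adjointableI[OF Sa Se] by (auto simp: pos_op_def)
qed

lemma sqrt_op:
  assumes "positive_op H A" and Ae: "A \<in> extensional (carrier H)"
  shows "positive_op H (sqrt_op H A)" "sqrt_op H A \<in> extensional (carrier H)"
    "x \<in> carrier H \<Longrightarrow> sqrt_op H A (sqrt_op H A x) = A x"
proof -
  let ?P = "\<lambda>S. pos_op H S \<and> compose (carrier H) S S = A"
  obtain t where t: "pos_bound H t A" using assms by (auto simp: positive_op_def)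
  define B where "B = restrict (op_root t A) (carrier H)"
  have pB: "positive_op H B" "B \<in> extensional (carrier H)"
    using positive_cong[OF positiveI[OF op_root_pos_bound[OF t]], of B] by (simp_all add: B_def)
  have BB: "B (B x) = A x" if "x \<in> carrier H" for x
    using that op_root_square[OF t] adjoints_carrier(1)[OF positive_adjoints[OF positiveI[OF op_root_pos_bound[OF t]]]]
    by (simp add: B_def)
  have "compose (carrier H) B B = A"
    by (rule extensionalityI[of _ "carrier H"]) (simp_all add: Ae compose_eq BB)
  then have "?P B" using pB by (simp add: pos_op_iff)
  moreover have "S = B" if S: "?P S" for S
  proof (rule extensionalityI[of _ "carrier H"])
    fix x assume x: "x \<in> carrier H"
    have SB: "S (S y) = B (B y)" if "y \<in> carrier H" for y
      using S that BB compose_eq[of y "carrier H" S S] by simp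
    show "S x = B x"
      by (rule positive_root_unique[OF _ pB(1) SB x]) (use S in \<open>simp_all add: pos_op_iff\<close>)
  qed (use S pB in \<open>simp_all add: pos_op_iff\<close>)
  ultimately have "sqrt_op H A = B"
    unfolding sqrt_op_def by (rule the_equality)
  then show "positive_op H (sqrt_op H A)" "sqrt_op H A \<in> extensional (carrier H)"
    "x \<in> carrier H \<Longrightarrow> sqrt_op H A (sqrt_op H A x) = A x"
    using pB BB by simp_all
qed

end

context hilbert_pair
begin

lemma hilbert_pair_swap: "hilbert_pair K H"
  by unfold_locales

lemma abs_op:
  assumes A: "A \<in> adjointable H K"
  shows "positive_op H (abs_op H K A)" "abs_op H K A \<in> extensional (carrier H)"
    "x \<in> carrier H \<Longrightarrow> abs_op H K A (abs_op H K A x) = adj H K A (A x)"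
proof -
  let ?S = "compose (carrier H) (adj H K A) A"
  have "positive_op H ?S"
    by (rule H.positive_cong[OF positive_star_mult[OF adjoints_adj(1)[OF A]]]) (simp add: compose_eq)
  then show "positive_op H (abs_op H K A)" "abs_op H K A \<in> extensional (carrier H)"
    "x \<in> carrier H \<Longrightarrow> abs_op H K A (abs_op H K A x) = adj H K A (A x)"
    using H.sqrt_op[of ?S] by (simp_all add: abs_op_def compose_eq)
qed

lemma sqrt_abs:
  assumes A: "A \<in> adjointable H K"
  shows "positive_op H (sqrt_abs H K A)" "sqrt_abs H K A \<in> extensional (carrier H)"
    "x \<in> carrier H \<Longrightarrow> sqrt_abs H K A (sqrt_abs H K A x) = abs_op H K A x"
  using H.sqrt_op[OF abs_op(1,2)[OF A]] by (simp_all add: sqrt_abs_def)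

text \<open>The kernel of \<open>A\<close> is orthogonal to the range of \<open>A'\<close> and, by
  continuity, to its closure, so \<open>x - y\<close> is orthogonal to itself, whether or not the
  closure is complemented.\<close>

lemma closure_range_inj:
  assumes A: "adjoints H K A A'"
    and xy: "x \<in> closure (A' ` carrier K)" "y \<in> closure (A' ` carrier K)" and eq: "A x = A y"
  shows "x = y"
proof -
  have sub: "A' ` carrier K \<subseteq> carrier H" using adjoints_carrier[OF A] by blast
  then have c: "x \<in> carrier H" "y \<in> carrier H"
    using xy H.closed_carrier closure_minimal by blast+
  have d: "x - y \<in> carrier H" using c by (simp add: H.closed)
  have 0: "hinner H (x - y) z = 0" if "z \<in> A' ` carrier K" for z
    using that c adjoints_carrier[OF A]
    by (auto simp: adjoints_hinner[OF A, symmetric] adjoints_diff[OF A] eq H.closed K.hinner_zero_left)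
  have "hinner H (x - y) x = 0" "hinner H (x - y) y = 0"
    using H.zero_if_orthogonal_closure[OF sub d 0] xy by auto
  then have "hinner H (x - y) (x - y) = 0" using c d by (simp add: H.hinner_diff_right)
  then show ?thesis using H.hinner_definite[OF d] by simp
qed

lemma the_reduced_solution:
  assumes A: "A \<in> adjointable H K" and ex: "has_reduced_solution E H K A C"
  shows "reduced_solution E H K A C (the_reduced_solution E H K A C)"
proof -
  obtain D where D: "reduced_solution E H K A C D"
    using ex by (auto simp: has_reduced_solution_def)
  have "D' = D" if D': "reduced_solution E H K A C D'" for D'
  proof (rule extensionalityI[of _ "carrier E"])
    fix x assume x: "x \<in> carrier E"
    have "compose (carrier E) A D' x = compose (carrier E) A D x"
      using D D' by (simp add: reduced_solution_def)
    then show "D' x = D x"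
      using D D' x by (intro closure_range_inj[OF adjoints_adj(1)[OF A]])
        (auto simp: reduced_solution_def compose_eq)
  qed (use D D' in \<open>auto simp: reduced_solution_def adjointable_def is_adjoint_iff\<close>)
  then show ?thesis
    unfolding the_reduced_solution_def using D by (metis theI)
qed

end

section \<open>Construction of \<open>V\<close>\<close>

context hilbert_pair
begin

text \<open>The operator \<open>V = |A\<^sup>*|\<^sup>-\<^sup>1\<^sup>/\<^sup>2 A = A |A|\<^sup>-\<^sup>1\<^sup>/\<^sup>2\<close> is a norm limit of \<open>A r(|A|)\<close> for polynomials \<open>r\<close>
  with \<open>t r(t)\<close> close to \<open>t\<^sup>1\<^sup>/\<^sup>2\<close>.\<close>

lemma V_exists:
  assumes A: "adjoints H K A A'"
    and Q: "positive_op H Q" "\<And>x. x \<in> carrier H \<Longrightarrow> Q (Q x) = A' (A x)"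
    and R: "positive_op K R" "\<And>y. y \<in> carrier K \<Longrightarrow> R (R y) = A (A' y)"
    and B: "positive_op K B" "\<And>y. y \<in> carrier K \<Longrightarrow> B (B y) = R y"
  obtains V V' where "adjoints H K V V'" "\<And>x. x \<in> carrier H \<Longrightarrow> B (V x) = A x"
    "\<And>x. x \<in> carrier H \<Longrightarrow> V x \<in> closure (B ` carrier K)"
proof -
  obtain t where t: "pos_bound H t Q" using Q by (auto simp: positive_op_def)
  define b where "b = H.op_root t Q"
  note Qa = positive_adjoints[OF Q(1)] and Ra = positive_adjoints[OF R(1)]
    and Ba = positive_adjoints[OF B(1)]
  have pb: "positive_op H b" and bb: "\<And>x. x \<in> carrier H \<Longrightarrow> b (b x) = Q x"
    using H.op_root_pos_bound[OF t] H.op_root_square[OF t] by (auto simp: b_def positive_op_def)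
  note ba = positive_adjoints[OF pb]
  define r where "r = scaled_quot t Q"
  have r: "adjoints H H (r n) (r n)" for n
    unfolding r_def by (rule H.quot_selfadj[OF t])
  define e where "e n = sqrt t * (2 * (1 - root_val n))" for n
  have err: "norm (Q (r n x) - b x) \<le> e n * norm x" if "x \<in> carrier H" for n x
    using H.op_root_err[OF t that] by (simp add: r_def b_def e_def)
  have e_mono: "e n \<le> e m" if "m \<le> n" for m n
    using that incseqD[OF incseq_SucI[of root_val, OF root_val_mono]] H.t_pos[OF t]
    by (simp add: e_def)
  have e0: "0 \<le> e n" for n
    using H.t_pos[OF t] root_val_bounds[of n] by (simp add: e_def)
  have e_lim: "e \<longlonglongrightarrow> 0"
    using tendsto_mult_right_zero[OF H.root_err_tendsto[OF H.unit_bound[OF t]]]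
    by (simp add: e_def[abs_def])
  note c = adjoints_carrier[OF A] adjoints_carrier(1)[OF Qa] adjoints_carrier(1)[OF Ra]
    adjoints_carrier(1)[OF Ba] adjoints_carrier(1)[OF ba] adjoints_carrier(1)[OF r]
  \<comment> \<open>\<open>A\<close> and \<open>|A|\<close> have equal norms on every vector, so
    estimates for \<open>Q (r n x)\<close> carry over to \<open>A (r n x)\<close>.\<close>
  have nA: "norm (A w) = norm (Q w)" if w: "w \<in> carrier H" for w
  proof -
    have "hinner K (A w) (A w) = hinner H (Q w) (Q w)"
      using w c by (simp add: adjoints_hinner[OF A] adjoints_hinner[OF Qa] Q(2))
    then show ?thesis using w c by (simp add: H.norm_eq K.norm_eq)
  qed
  have AQ: "A (Q x) = R (A x)" if "x \<in> carrier H" for x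
    by (rule positive_intertwine[OF Q(1) R(1) A _ that]) (simp add: Q(2) R(2) c)
  have Ab: "A (b x) = B (A x)" if "x \<in> carrier H" for x
    by (rule positive_intertwine[OF pb B(1) A _ that]) (simp add: bb B(2) c AQ)
  have T: "adjoints H K (\<lambda>x. A (r n x)) (\<lambda>y. r n (A' y))" for n
    by (rule adjoints_compose[OF r A])
  have Cauchy: "norm (A (r m x) - A (r n x)) \<le> 2 * e m * norm x"
    if mn: "m \<le> n" and x: "x \<in> carrier H" for m n x
  proof -
    have "norm (A (r m x) - A (r n x)) = norm (A (r m x - r n x))"
      using x c by (simp add: adjoints_diff[OF A])
    also have "\<dots> = norm ((Q (r m x) - b x) - (Q (r n x) - b x))"
      using x c by (simp add: nA H.closed H.self.adjoints_diff[OF Qa])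
    also have "\<dots> \<le> e m * norm x + e n * norm x"
      using err[OF x] by (intro order_trans[OF norm_triangle_ineq4 add_mono])
    also have "\<dots> \<le> 2 * e m * norm x"
      using mult_right_mono[OF e_mono[OF mn] norm_ge_zero[of x]] by (simp add: mult.commute)
    finally show ?thesis .
  qed
  have lim0: "(\<lambda>n. 2 * e n) \<longlonglongrightarrow> 0" using tendsto_mult_right_zero[OF e_lim] by simp
  have nn: "0 \<le> 2 * e n" for n using e0 by simp
  define V V' where "V x = lim (\<lambda>n. A (r n x))" and "V' y = lim (\<lambda>n. r n (A' y))" for x y
  have V: "adjoints H K V V'"
    unfolding V_def[abs_def] V'_def[abs_def] by (rule adjoints_limit(1)[OF T Cauchy lim0 nn])
  have Vlim: "(\<lambda>n. A (r n x)) \<longlonglongrightarrow> V x" if "x \<in> carrier H" for x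
    unfolding V_def by (rule adjoints_limit(2)[OF T Cauchy lim0 nn that])
  have BV: "B (V x) = A x" if x: "x \<in> carrier H" for x
  proof (rule LIMSEQ_unique)
    show "(\<lambda>n. B (A (r n x))) \<longlonglongrightarrow> B (V x)"
      using Vlim[OF x] x c adjoints_carrier(1)[OF V] by (intro K.self.adjoints_tendsto[OF Ba]) auto
    have "(\<lambda>n. Q (r n x) - b x) \<longlonglongrightarrow> 0"
      by (rule Lim_null_comparison[OF _ tendsto_mult_left_zero[OF e_lim, of "norm x"]]) (simp add: err[OF x])
    then have "(\<lambda>n. Q (r n x)) \<longlonglongrightarrow> b x" by (rule LIM_zero_cancel)
    then have "(\<lambda>n. b (Q (r n x))) \<longlonglongrightarrow> b (b x)"
      using x c by (intro H.self.adjoints_tendsto[OF ba]) auto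
    then have lim: "(\<lambda>n. norm (b (Q (r n x)) - b (b x))) \<longlonglongrightarrow> 0"
      by (intro tendsto_norm_zero LIM_zero)
    \<comment> \<open>By \<open>B A = A b\<close> and the equality of norms, the error is moved to
      \<open>H\<close>, where the limit is known.\<close>
    have "norm (B (A (r n x)) - A x) = norm (b (Q (r n x)) - b (b x))" for n
    proof -
      have "b (Q y) = Q (b y)" if "y \<in> carrier H" for y
        using that c by (simp add: bb[symmetric])
      then have "norm (b (Q (r n x)) - b (b x)) = norm (Q (b (r n x) - x))"
        using x c by (simp add: H.self.adjoints_diff[OF Qa] bb)
      also have "\<dots> = norm (A (b (r n x) - x))"
        using x c by (simp add: nA H.closed)
      finally show ?thesis using x c by (simp add: adjoints_diff[OF A] Ab)
    qed
    then have "(\<lambda>n. norm (B (A (r n x)) - A x)) \<longlonglongrightarrow> 0" using lim by simp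
    then show "(\<lambda>n. B (A (r n x))) \<longlonglongrightarrow> A x"
      by (rule LIM_zero_cancel[OF tendsto_norm_zero_cancel])
  qed
  have "V x \<in> closure (B ` carrier K)" if x: "x \<in> carrier H" for x
  proof -
    have "A (r n x) \<in> B ` carrier K" for n
      using BV[of "r n x"] x c adjoints_carrier(1)[OF V] by (metis imageI)
    then show ?thesis
      unfolding closure_sequential using Vlim[OF x] by (intro exI[of _ "\<lambda>n. A (r n x)"]) simp
  qed
  then show thesis using that[OF V BV] by blast
qed

lemma V_op:
  assumes A: "A \<in> adjointable H K"
  defines "B \<equiv> sqrt_abs K H (adj H K A)"
  shows "V_op H K A \<in> adjointable H K"
    and "x \<in> carrier H \<Longrightarrow> B (V_op H K A x) = A x"
    and "x \<in> carrier H \<Longrightarrow> V_op H K A x \<in> closure (B ` carrier K)"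
proof -
  interpret S: hilbert_pair K H by (rule hilbert_pair_swap)
  note Aa = adjoints_adj[OF A]
  have A': "adj H K A \<in> adjointable K H"
    by (rule S.adjointableI[OF adjoints_sym[OF Aa(1)] Aa(3)])
  have "is_adjoint K H (adj H K A) A"
    using Aa adjoints_sym by (simp add: is_adjoint_iff)
  then have AA: "adj K H (adj H K A) = A" by (rule S.adj_eq)
  note B = S.sqrt_abs[OF A', folded B_def] and R = S.abs_op[OF A', unfolded AA]
  note Ba = positive_adjoints[OF B(1)]
  have Bad: "B \<in> adjointable K K" by (rule K.self.adjointableI[OF Ba B(2)])
  have adjB: "adj K K B = B"
    using Ba B(2) by (intro K.self.adj_eq) (simp add: is_adjoint_iff)
  obtain V V' where V: "adjoints H K V V'" "\<And>x. x \<in> carrier H \<Longrightarrow> B (V x) = A x"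
    "\<And>x. x \<in> carrier H \<Longrightarrow> V x \<in> closure (B ` carrier K)"
    using V_exists[OF Aa(1) abs_op(1,3)[OF A] R(1,3) B(1,3)] by blast
  let ?V = "restrict V (carrier H)"
  have "reduced_solution H K K B A ?V"
    unfolding reduced_solution_def adjB
  proof (intro conjI)
    show "?V \<in> adjointable H K"
      by (rule adjointableI[OF adjoints_cong[OF V(1)]]) auto
    show "compose (carrier H) B ?V = A"
      by (rule extensionalityI[of _ "carrier H"]) (simp_all add: Aa compose_eq V(2))
    show "?V ` carrier H \<subseteq> closure (B ` carrier K)" using V(3) by auto
  qed
  then have "reduced_solution H K K B A (V_op H K A)"
    unfolding V_op_def B_def[symmetric]
    by (intro K.self.the_reduced_solution Bad) (auto simp: has_reduced_solution_def)
  then show "V_op H K A \<in> adjointable H K"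
    and "x \<in> carrier H \<Longrightarrow> B (V_op H K A x) = A x"
    and "x \<in> carrier H \<Longrightarrow> V_op H K A x \<in> closure (B ` carrier K)"
    using compose_eq[of x "carrier H" B "V_op H K A"] by (auto simp: reduced_solution_def adjB)
qed

end

section \<open>Relations between \<open>A\<close>, \<open>V\<^sub>A\<close> and the roots of \<open>|A|\<close> and \<open>|A\<^sup>*|\<close>\<close>

text \<open>Here \<open>Q = |A|\<close>, \<open>b = |A|\<^sup>1\<^sup>/\<^sup>2\<close>, \<open>R = |A\<^sup>*|\<close> and \<open>B = |A\<^sup>*|\<^sup>1\<^sup>/\<^sup>2\<close>.\<close>

locale polar_data = hilbert_pair H K
  for H :: "('x::complex_normed_vector, 'a::cstar_algebra) hmodule"
    and K :: "('y::complex_normed_vector, 'a) hmodule" +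
  fixes A A' V V' Q b R B
  assumes A: "adjoints H K A A'" and V: "adjoints H K V V'"
    and Q: "positive_op H Q" and QQ: "\<And>x. x \<in> carrier H \<Longrightarrow> Q (Q x) = A' (A x)"
    and b: "positive_op H b" and bb: "\<And>x. x \<in> carrier H \<Longrightarrow> b (b x) = Q x"
    and R: "positive_op K R" and RR: "\<And>y. y \<in> carrier K \<Longrightarrow> R (R y) = A (A' y)"
    and B: "positive_op K B" and BB: "\<And>y. y \<in> carrier K \<Longrightarrow> B (B y) = R y"
    and BV: "\<And>x. x \<in> carrier H \<Longrightarrow> B (V x) = A x"
    and V_range: "\<And>x. x \<in> carrier H \<Longrightarrow> V x \<in> closure (B ` carrier K)"

text \<open>\<open>B\<close> is the root of \<open>B B\<close>, and the approximants of that root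
  lie in the range of \<open>B B\<close>.\<close>

lemma (in hilbert_module) range_root_approx:
  assumes B: "positive_op H B" and y: "y \<in> carrier H"
  obtains w where "\<And>n. w n \<in> carrier H" "(\<lambda>n. B (B (w n))) \<longlonglongrightarrow> B y"
proof -
  obtain t where t: "pos_bound H t (\<lambda>x. B (B x))"
    using positive_square[OF positive_adjoints[OF B]] by (auto simp: positive_op_def)
  let ?w = "\<lambda>n. scaled_quot t (\<lambda>x. B (B x)) n y"
  have "(\<lambda>n. sqrt t * (2 * (1 - root_val n)) * norm y) \<longlonglongrightarrow> 0"
    by (intro tendsto_mult_left_zero tendsto_mult_right_zero root_err_tendsto[OF unit_bound[OF t]])
  then have "(\<lambda>n. B (B (?w n)) - op_root t (\<lambda>x. B (B x)) y) \<longlonglongrightarrow> 0"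
    by (rule Lim_null_comparison[rotated]) (intro always_eventually allI op_root_err[OF t y])
  then have "(\<lambda>n. B (B (?w n))) \<longlonglongrightarrow> B y"
    using LIM_zero_cancel positive_eq_op_root[OF t B refl y] by simp
  moreover have "?w n \<in> carrier H" for n
    using adjoints_carrier(1)[OF quot_selfadj[OF t] y] .
  ultimately show thesis by (intro that[of ?w])
qed

context polar_data
begin

lemmas selfadj = positive_adjoints[OF Q] positive_adjoints[OF b] positive_adjoints[OF R]
  positive_adjoints[OF B]

lemmas carrs = adjoints_carrier[OF A] adjoints_carrier[OF V] adjoints_carrier(1)[OF selfadj(1)]
  adjoints_carrier(1)[OF selfadj(2)] adjoints_carrier(1)[OF selfadj(3)]
  adjoints_carrier(1)[OF selfadj(4)]

lemma V'_B:
  assumes y: "y \<in> carrier K"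
  shows "V' (B y) = A' y"
  using y carrs
  by (intro H.eqI_hinner)
    (simp_all add: adjoints_hinner[OF V, symmetric] adjoints_hinner[OF A, symmetric] BV[symmetric]
      adjoints_hinner[OF selfadj(4)])

text \<open>\<open>B\<close> is cancelled twice: from \<open>B V V' B = B R B\<close>, and then,
  after passing to adjoints, from \<open>B V V' = B R\<close>. The values lie in the closure of the
  range of \<open>B\<close>, where \<open>B\<close> is injective.\<close>

lemma V_V':
  assumes y: "y \<in> carrier K"
  shows "V (V' y) = R y"
proof -
  have R_in: "R y \<in> closure (B ` carrier K)" if "y \<in> carrier K" for y
    unfolding BB[OF that, symmetric]
    using that carrs by (intro subsetD[OF closure_subset] imageI)
  have inj: "u = v" if "u \<in> closure (B ` carrier K)" "v \<in> closure (B ` carrier K)" "B u = B v" for u v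
    using K.self.closure_range_inj[OF selfadj(4)] that by blast
  have VB: "V (V' (B y)) = R (B y)" if y: "y \<in> carrier K" for y
  proof (rule inj)
    show "B (V (V' (B y))) = B (R (B y))"
      using y carrs by (simp add: V'_B BV RR[symmetric]) (simp add: BB[symmetric])
  qed (use y carrs V_range R_in in auto)
  have eq: "B (V (V' y)) = B (R y)"
  proof (rule K.eqI_hinner)
    fix z assume z: "z \<in> carrier K"
    have "hinner K z (B (V (V' y))) = hinner K (V (V' (B z))) y"
      using z y carrs by (simp add: adjoints_hinner[OF V] adjoints_hinner[OF adjoints_sym[OF V]]
          adjoints_hinner[OF selfadj(4)])
    also have "\<dots> = hinner K z (B (R y))"
      using z y carrs by (simp add: VB adjoints_hinner[OF selfadj(3)] adjoints_hinner[OF selfadj(4)])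
    finally show "hinner K z (B (V (V' y))) = hinner K z (B (R y))" .
  qed (use y carrs in auto)
  show ?thesis
    by (rule inj[OF V_range[OF carrs(4)[OF y]] R_in[OF y] eq])
qed

text \<open>\<open>V' V\<close> is positive, and by \<open>V V' = B B\<close> its square is
  \<open>V' B B V = A' A\<close>, so it is the root \<open>|A|\<close>.\<close>

lemma V'_V:
  assumes x: "x \<in> carrier H"
  shows "V' (V x) = Q x"
proof (rule H.positive_root_unique[OF positive_star_mult[OF V] Q _ x])
  fix x assume x: "x \<in> carrier H"
  have "V' (V (V' (V x))) = V' (B (B (V x)))"
    using x carrs by (simp add: V_V' BB)
  then show "V' (V (V' (V x))) = Q (Q x)"
    using x carrs by (simp add: V'_B BV QQ)
qed

text \<open>\<open>V b b = V V' V = B B V\<close>, so taking roots gives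
  \<open>V b = B V\<close>.\<close>

lemma V_b:
  assumes x: "x \<in> carrier H"
  shows "V (b x) = A x"
proof -
  have "V (b x) = B (V x)"
  proof (rule positive_intertwine[OF b B V _ x])
    fix x assume "x \<in> carrier H"
    then show "V (b (b x)) = B (B (V x))"
      using carrs by (simp add: bb BB V'_V[symmetric] V_V')
  qed
  then show ?thesis using BV[OF x] by simp
qed

lemma norm_V: "x \<in> carrier H \<Longrightarrow> norm (V x) = norm (b x)"
  using carrs by (simp add: H.norm_eq K.norm_eq adjoints_hinner[OF V] adjoints_hinner[OF selfadj(2)]
      V'_V bb)

lemma norm_V': "y \<in> carrier K \<Longrightarrow> norm (V' y) = norm (B y)"
  using carrs by (simp add: H.norm_eq K.norm_eq adjoints_hinner[OF adjoints_sym[OF V]]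
      adjoints_hinner[OF selfadj(4)] V_V' BB)

lemma B_in_closure_V:
  assumes y: "y \<in> carrier K"
  shows "B y \<in> closure (V ` carrier H)"
proof -
  obtain w where w: "\<And>n. w n \<in> carrier K" "(\<lambda>n. B (B (w n))) \<longlonglongrightarrow> B y"
    using K.range_root_approx[OF B y] by blast
  have "B (B (w n)) \<in> V ` carrier H" for n
    using w carrs by (auto simp: BB V_V'[symmetric])
  then show ?thesis
    unfolding closure_sequential using w by (intro exI[of _ "\<lambda>n. B (B (w n))"]) simp
qed

text \<open>Two applications of the preceding approximation give \<open>B w\<^sub>n\<close> with \<open>B\<^sup>3 w\<^sub>n\<close> close to \<open>B y\<close>, and
  \<open>V'\<close> has the same norm as \<open>B\<close>.\<close>

lemma V'_in_closure_b:
  assumes y: "y \<in> carrier K"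
  shows "V' y \<in> closure (b ` carrier H)"
proof -
  let ?C = "(\<lambda>w. B (R w)) ` carrier K"
  have "R z \<in> closure ?C" if z: "z \<in> carrier K" for z
  proof -
    obtain w where w: "\<And>n. w n \<in> carrier K" "(\<lambda>n. R (R (w n))) \<longlonglongrightarrow> R z"
      using K.range_root_approx[OF R z] by blast
    have "R (R (w n)) = B (R (B (w n)))" for n
      using w(1)[of n] carrs by (simp add: BB[symmetric])
    then have "R (R (w n)) \<in> ?C" for n
      using w carrs by auto
    then show ?thesis
      unfolding closure_sequential using w by (intro exI[of _ "\<lambda>n. R (R (w n))"]) simp
  qed
  then have sub: "R ` carrier K \<subseteq> closure ?C" by blast
  obtain v where v: "\<And>n. v n \<in> carrier K" "(\<lambda>n. B (B (v n))) \<longlonglongrightarrow> B y"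
    using K.range_root_approx[OF B y] by blast
  have "B y \<in> closure (R ` carrier K)"
    unfolding closure_sequential
    using v by (intro exI[of _ "\<lambda>n. B (B (v n))"]) (simp add: BB)
  then have "B y \<in> closure ?C"
    using closure_minimal[OF sub closed_closure] by blast
  then obtain u where u: "\<And>n. u n \<in> ?C" "u \<longlonglongrightarrow> B y"
    unfolding closure_sequential by blast
  then have "\<exists>w. w \<in> carrier K \<and> u n = B (R w)" for n
    using imageE[OF u(1)[of n]] by metis
  then obtain w where w: "\<And>n. w n \<in> carrier K" "\<And>n. u n = B (R (w n))" by metis
  have "(\<lambda>n. norm (V' (R (w n)) - V' y)) \<longlonglongrightarrow> 0"
  proof -
    have "norm (V' (R (w n)) - V' y) = norm (u n - B y)" for n
    proof -
      have "norm (V' (R (w n)) - V' y) = norm (V' (R (w n) - y))"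
        using w y carrs hilbert_pair.adjoints_diff[OF hilbert_pair_swap adjoints_sym[OF V]] by simp
      also have "\<dots> = norm (B (R (w n) - y))"
        using w y carrs by (intro norm_V') (simp add: K.closed)
      finally show ?thesis
        using w y carrs by (simp add: K.self.adjoints_diff[OF selfadj(4)])
    qed
    then show ?thesis using tendsto_norm_zero[OF LIM_zero[OF u(2)]] by simp
  qed
  then have lim: "(\<lambda>n. V' (R (w n))) \<longlonglongrightarrow> V' y"
    by (rule LIM_zero_cancel[OF tendsto_norm_zero_cancel])
  \<comment> \<open>\<open>V' R = V' V V' = Q V'\<close>, which puts the approximants into the range
    of \<open>b\<close>.\<close>
  have "V' (R (w n)) = b (b (V' (w n)))" for n
    using w(1)[of n] carrs by (simp add: V_V'[symmetric] V'_V bb)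
  then have "V' (R (w n)) \<in> b ` carrier H" for n
    using w(1) carrs by auto
  then show ?thesis
    unfolding closure_sequential using lim by (intro exI[of _ "\<lambda>n. V' (R (w n))"]) simp
qed

text \<open>The solution \<open>E\<close> is confined to the closure of the range of
  \<open>V'\<close>, while \<open>F*\<close> is understood only after \<open>b\<close>. The next
  inclusion does the same for \<open>E2\<close>, with \<open>B\<close>, and \<open>F2*\<close>, with
  \<open>V\<close>.\<close>

lemma closure_V'_subset: "closure (V' ` carrier K) \<subseteq> closure (b ` carrier H)"
  using V'_in_closure_b by (intro closure_minimal) auto

lemma closure_B_subset: "closure (B ` carrier K) \<subseteq> closure (V ` carrier H)"
  using B_in_closure_V by (intro closure_minimal) auto

text \<open>\<open>V (e + b w) = 0\<close> and the equality of norms give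
  \<open>b (e + b w) = 0\<close>; now \<open>e\<close> and \<open>- b w\<close> lie in the closure
  of the range of \<open>b\<close>, where \<open>b\<close> is injective.\<close>

lemma solution_V:
  assumes e: "e \<in> closure (V' ` carrier K)" and w: "w \<in> carrier H" and eq: "V e = - A w"
  shows "e = - b w"
proof (rule H.self.closure_range_inj[OF selfadj(2)])
  show eb: "e \<in> closure (b ` carrier H)" using closure_V'_subset e by blast
  have "b ` carrier H \<subseteq> carrier H" using carrs by blast
  then have ec: "e \<in> carrier H"
    using eb closure_minimal[OF _ H.closed_carrier] by blast
  have "- b w = b (- w)" using w by (simp add: H.self.adjoints_minus[OF selfadj(2)])
  then show "- b w \<in> closure (b ` carrier H)"
    using w closure_subset H.minus_closed by fastforce
  have "V (e + b w) = 0"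
    using ec w carrs by (simp add: adjoints_add[OF V] V_b eq)
  then have "b (e + b w) = 0"
    using norm_V[of "e + b w"] ec w carrs by (simp add: H.closed)
  then show "b e = b (- b w)"
    using ec w carrs by (simp add: H.self.adjoints_add[OF selfadj(2)]
        H.self.adjoints_minus[OF selfadj(2)] eq_neg_iff_add_eq_0)
qed

lemma solution_B:
  assumes e: "e \<in> closure (B ` carrier K)" and w: "w \<in> carrier H" and eq: "B e = - A w"
  shows "e = - V w"
proof (rule K.self.closure_range_inj[OF selfadj(4) e])
  show "- V w \<in> closure (B ` carrier K)"
    using V_range[of "- w"] w by (simp add: adjoints_minus[OF V] H.closed)
  show "B e = B (- V w)"
    using w carrs by (simp add: eq K.self.adjoints_minus[OF selfadj(4)] BV)
qed

text \<open>One sequence serves both components: the first limit is fed to \<open>F*\<close>, the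
  second, from \<open>V b = A\<close>, controls the component in the complement of
  \<open>N\<close>.\<close>

lemma approx_b:
  assumes e: "e \<in> closure (V' ` carrier K)"
  obtains w where "\<And>n. w n \<in> carrier H" "(\<lambda>n. b (w n)) \<longlonglongrightarrow> e" "(\<lambda>n. A (w n)) \<longlonglongrightarrow> V e"
proof -
  have "e \<in> closure (b ` carrier H)" using closure_V'_subset e by blast
  then obtain u where u: "\<And>n. u n \<in> b ` carrier H" "u \<longlonglongrightarrow> e"
    unfolding closure_sequential by blast
  then have "\<exists>w. w \<in> carrier H \<and> u n = b w" for n
    using imageE[OF u(1)[of n]] by metis
  then obtain w where w: "\<And>n. w n \<in> carrier H" "\<And>n. u n = b (w n)" by metis
  have lim: "(\<lambda>n. b (w n)) \<longlonglongrightarrow> e" using u(2) by (simp add: w(2)[symmetric])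
  moreover have "e \<in> carrier H" using H.limit_in_carrier[OF lim] w carrs by simp
  ultimately have "(\<lambda>n. V (b (w n))) \<longlonglongrightarrow> V e"
    using w carrs by (intro adjoints_tendsto[OF V]) auto
  then show thesis using that[OF w(1) lim] by (simp add: V_b w(1))
qed

lemma approx_V:
  assumes e: "e \<in> closure (B ` carrier K)"
  obtains w where "\<And>n. w n \<in> carrier H" "(\<lambda>n. V (w n)) \<longlonglongrightarrow> e" "(\<lambda>n. A (w n)) \<longlonglongrightarrow> B e"
proof -
  have "e \<in> closure (V ` carrier H)" using closure_B_subset e by blast
  then obtain u where u: "\<And>n. u n \<in> V ` carrier H" "u \<longlonglongrightarrow> e"
    unfolding closure_sequential by blast
  then have "\<exists>w. w \<in> carrier H \<and> u n = V w" for n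
    using imageE[OF u(1)[of n]] by metis
  then obtain w where w: "\<And>n. w n \<in> carrier H" "\<And>n. u n = V (w n)" by metis
  have lim: "(\<lambda>n. V (w n)) \<longlonglongrightarrow> e" using u(2) by (simp add: w(2)[symmetric])
  moreover have "e \<in> carrier K" using K.limit_in_carrier[OF lim] w carrs by simp
  ultimately have "(\<lambda>n. B (V (w n))) \<longlonglongrightarrow> B e"
    using w carrs by (intro K.self.adjoints_tendsto[OF selfadj(4)]) auto
  then show thesis using that[OF w(1) lim] by (simp add: BV w(1))
qed

end

lemma (in hilbert_pair) polar_data:
  assumes A: "A \<in> adjointable H K"
  shows "polar_data H K A (adj H K A) (V_op H K A) (adj H K (V_op H K A)) (abs_op H K A)
    (sqrt_abs H K A) (abs_op K H (adj H K A)) (sqrt_abs K H (adj H K A))"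
proof -
  interpret S: hilbert_pair K H by (rule hilbert_pair_swap)
  note Aa = adjoints_adj[OF A]
  have A': "adj H K A \<in> adjointable K H"
    by (rule S.adjointableI[OF adjoints_sym[OF Aa(1)] Aa(3)])
  have "is_adjoint K H (adj H K A) A"
    using Aa adjoints_sym by (simp add: is_adjoint_iff)
  then have AA: "adj K H (adj H K A) = A" by (rule S.adj_eq)
  show ?thesis
    by unfold_locales
      (use Aa(1) abs_op[OF A] sqrt_abs[OF A] S.abs_op[OF A', unfolded AA] S.sqrt_abs[OF A']
        V_op[OF A] adjoints_adj(1)[OF V_op(1)[OF A]] in blast)+
qed

section \<open>Submodules and blocks\<close>

lemma carrier_sub [simp]: "carrier (sub H M) = M"
  and hinner_sub [simp]: "hinner (sub H M) = hinner H"
  and act_sub [simp]: "act (sub H M) = act H"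
  by (simp_all add: sub_def)

lemma (in hilbert_module) hilbert_module_sub:
  assumes M: "closed_submodule H M"
  shows "hilbert_module (sub H M)"
proof -
  have sub: "x \<in> M \<Longrightarrow> x \<in> carrier H" for x using M by (auto simp: closed_submodule_def)
  have "complete M"
    using complete_closed_subset[OF _ _ complete_carrier] M by (simp add: closed_submodule_def)
  then show ?thesis
    using M by unfold_locales
      (auto simp: closed_submodule_def sub act_add_left act_add_right act_mult act_scaleC_left
        act_scaleC_right hinner_linear hinner_act_right star_hinner hinner_pos hinner_definite norm_eq)
qed

lemma (in hilbert_module) ortho_closed_submodule:
  assumes M: "M \<subseteq> carrier H"
  shows "closed_submodule H (ortho H M)"
  unfolding closed_submodule_def
proof (intro conjI)
  show "closed (ortho H M)"
    unfolding closed_sequential_limits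
  proof (intro allI impI, elim conjE)
    fix X l assume X: "\<forall>n. X n \<in> ortho H M" "X \<longlonglongrightarrow> l"
    then have c: "X n \<in> carrier H" for n by (auto simp: ortho_def)
    have l: "l \<in> carrier H" using limit_in_carrier[OF X(2) c] .
    have "hinner H y l = 0" if y: "y \<in> M" for y
    proof (rule LIMSEQ_unique)
      show "(\<lambda>n. hinner H y (X n)) \<longlonglongrightarrow> hinner H y l"
        using y M by (intro tendsto_hinner_right[OF X(2) c l]) auto
      show "(\<lambda>n. hinner H y (X n)) \<longlonglongrightarrow> 0"
        using X y by (simp add: ortho_def)
    qed
    then show "l \<in> ortho H M" using l by (simp add: ortho_def)
  qed
qed (use M in \<open>auto simp: ortho_def closed hinner_linear hinner_act_right subset_eq\<close>)

locale complemented = hilbert_module H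
  for H :: "('x::complex_normed_vector, 'a::cstar_algebra) hmodule" +
  fixes M
  assumes M: "orth_complemented H M"
begin

lemma M_closed: "closed_submodule H M" and M_carrier: "x \<in> M \<Longrightarrow> x \<in> carrier H"
  using M by (auto simp: orth_complemented_def closed_submodule_def)

lemma M_subset: "M \<subseteq> carrier H"
  using M_carrier by blast

lemma ortho_carrier: "x \<in> ortho H M \<Longrightarrow> x \<in> carrier H"
  by (simp add: ortho_def)

lemma ortho_closed: "closed_submodule H (ortho H M)"
  by (rule ortho_closed_submodule[OF M_subset])

lemma M_minus: "x \<in> M \<Longrightarrow> y \<in> M \<Longrightarrow> x - y \<in> M"
  and ortho_minus: "u \<in> ortho H M \<Longrightarrow> v \<in> ortho H M \<Longrightarrow> u - v \<in> ortho H M"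
  using hilbert_module.diff_closed[OF hilbert_module_sub[OF M_closed]]
    hilbert_module.diff_closed[OF hilbert_module_sub[OF ortho_closed]] by simp_all

lemma M_inter_ortho: "x \<in> M \<Longrightarrow> x \<in> ortho H M \<Longrightarrow> x = 0"
  using hinner_definite by (auto simp: ortho_def)

lemma proj_unique:
  assumes x: "x \<in> carrier H" and p: "p \<in> M" "x - p \<in> ortho H M"
  shows "proj H M x = p"
proof -
  have "q = p" if q: "q \<in> M \<and> x - q \<in> ortho H M" for q
  proof -
    have "(x - p) - (x - q) \<in> ortho H M" by (rule ortho_minus) (use p q in auto)
    then have "q - p = 0" using M_inter_ortho[of "q - p"] M_minus p q by simp
    then show ?thesis by simp
  qed
  with p have "(THE q. q \<in> M \<and> x - q \<in> ortho H M) = p"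
    by (intro the_equality conjI)
  then show ?thesis using x by (simp add: proj_def)
qed

lemma proj_in: "x \<in> carrier H \<Longrightarrow> proj H M x \<in> M"
  and coproj_in: "x \<in> carrier H \<Longrightarrow> coproj H M x \<in> ortho H M"
proof -
  assume x: "x \<in> carrier H"
  then obtain m w where mw: "x = m + w" "m \<in> M" "w \<in> ortho H M"
    using M by (auto simp: orth_complemented_def)
  then have "proj H M x = m" using x by (intro proj_unique) auto
  then show "proj H M x \<in> M" "coproj H M x \<in> ortho H M"
    using mw x by (simp_all add: coproj_def)
qed

lemma proj_add_coproj: "x \<in> carrier H \<Longrightarrow> proj H M x + coproj H M x = x"
  by (simp add: coproj_def)

lemma proj_M: "x \<in> M \<Longrightarrow> proj H M x = x"
  using ortho_closed by (intro proj_unique) (auto simp: M_carrier closed_submodule_def)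

lemma proj_ortho: "x \<in> ortho H M \<Longrightarrow> proj H M x = 0"
  using M_closed by (intro proj_unique) (auto simp: ortho_carrier closed_submodule_def)

lemma coproj_ortho: "x \<in> ortho H M \<Longrightarrow> coproj H M x = x"
  by (simp add: coproj_def ortho_carrier proj_ortho)

lemma hinner_M_ortho: "x \<in> M \<Longrightarrow> y \<in> ortho H M \<Longrightarrow> hinner H x y = 0"
  and hinner_ortho_M: "x \<in> M \<Longrightarrow> y \<in> ortho H M \<Longrightarrow> hinner H y x = 0"
  using star_hinner[of x y] by (auto simp: ortho_def M_carrier)

lemma hinner_proj: "x \<in> carrier H \<Longrightarrow> y \<in> M \<Longrightarrow> hinner H (proj H M x) y = hinner H x y"
proof -
  assume x: "x \<in> carrier H" and y: "y \<in> M"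
  have "hinner H (proj H M x + coproj H M x) y = hinner H (proj H M x) y"
    using x y proj_in coproj_in M_carrier ortho_carrier
    by (simp add: hinner_add_left hinner_ortho_M)
  then show ?thesis using x by (simp add: proj_add_coproj)
qed

lemma hinner_coproj:
  "x \<in> carrier H \<Longrightarrow> y \<in> ortho H M \<Longrightarrow> hinner H (coproj H M x) y = hinner H x y"
proof -
  assume x: "x \<in> carrier H" and y: "y \<in> ortho H M"
  have "hinner H (proj H M x + coproj H M x) y = hinner H (coproj H M x) y"
    using x y proj_in coproj_in M_carrier ortho_carrier
    by (simp add: hinner_add_left hinner_M_ortho)
  then show ?thesis using x by (simp add: proj_add_coproj)
qed

lemma adjoints_inclusion_proj: "adjoints (sub H M) H (\<lambda>x. x) (proj H M)"
  unfolding adjoints_def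
proof (intro conjI ballI)
  fix x y assume "x \<in> carrier (sub H M)" "y \<in> carrier H"
  then show "hinner H x y = hinner (sub H M) x (proj H M y)"
    using hinner_proj[of y x] proj_in M_carrier star_hinner[of x y] star_hinner[of x "proj H M y"]
    by (metis carrier_sub hinner_sub star_hinner)
qed (simp_all add: M_carrier proj_in)

lemma adjoints_inclusion_coproj: "adjoints (sub H (ortho H M)) H (\<lambda>x. x) (coproj H M)"
  unfolding adjoints_def
proof (intro conjI ballI)
  fix x y assume "x \<in> carrier (sub H (ortho H M))" "y \<in> carrier H"
  then show "hinner H x y = hinner (sub H (ortho H M)) x (coproj H M y)"
    using hinner_coproj[of y x] coproj_in ortho_carrier
    by (metis carrier_sub hinner_sub star_hinner)
qed (simp_all add: ortho_carrier coproj_in)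

text \<open>The norm of the product type is not the one of the inner product, so results on
  \<open>hilbert_pair\<close> do not apply to the direct sum. The adjoint, addition of the
  components, is identified directly by definiteness in \<open>H\<close>.\<close>

lemma adj_U_op:
  assumes a: "a \<in> M"
  shows "adj H (hsum (sub H M) (sub H (ortho H M))) (U_op H M) (a, 0) = a"
proof -
  let ?S = "hsum (sub H M) (sub H (ortho H M))"
  define U' where "U' = restrict (\<lambda>u. fst u + snd u) (M \<times> ortho H M)"
  have S: "carrier ?S = M \<times> ortho H M"
    and hS: "hinner ?S u v = hinner H (fst u) (fst v) + hinner H (snd u) (snd v)" for u v
    by (simp_all add: hsum_def)
  have U: "is_adjoint H ?S (U_op H M) U'"
    unfolding is_adjoint_def S
  proof (intro conjI ballI)
    fix x y assume x: "x \<in> carrier H" and y: "y \<in> M \<times> ortho H M"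
    then show "hinner ?S (U_op H M x) y = hinner H x (U' y)"
      by (auto simp: hS U_op_def U'_def hinner_proj hinner_coproj hinner_add_right M_carrier ortho_carrier)
  qed (auto simp: U_op_def U'_def proj_in coproj_in add_closed M_carrier ortho_carrier)
  have "adj H ?S (U_op H M) = U'"
    unfolding adj_def
  proof (rule the_equality)
    show "is_adjoint H ?S (U_op H M) U'" by (rule U)
    fix W assume W: "is_adjoint H ?S (U_op H M) W"
    show "W = U'"
    proof (rule extensionalityI[of _ "carrier ?S"])
      fix y assume y: "y \<in> carrier ?S"
      show "W y = U' y"
        using U W y by (intro eqI_hinner) (auto simp: is_adjoint_def PiE_def)
    qed (use U W in \<open>auto simp: is_adjoint_def PiE_def\<close>)
  qed
  then show ?thesis
    using a ortho_closed by (simp add: U'_def closed_submodule_def)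
qed

end

text \<open>Adjoints are taken in \<open>b' F = C'\<close>; the equations for \<open>F\<close> and
  for \<open>F2\<close> both have this form.\<close>

lemma factor_adjoints:
  assumes mod: "hilbert_module X" "hilbert_module Y" "hilbert_module Z"
    and C: "adjoints X Z C C'" and b: "adjoints X Y b b'" and F: "adjoints Z Y F F'"
    and eq: "\<And>z. z \<in> carrier Z \<Longrightarrow> b' (F z) = C' z" and w: "w \<in> carrier X"
  shows "C w = F' (b w)"
proof -
  interpret XZ: hilbert_pair X Z using mod by (simp add: hilbert_pair_def)
  interpret XY: hilbert_pair X Y using mod by (simp add: hilbert_pair_def)
  note c = adjoints_carrier[OF C] adjoints_carrier[OF b] adjoints_carrier[OF F]
  show ?thesis
    using w c
    by (intro XZ.K.eqI_hinner)
      (simp_all add: adjoints_hinner[OF XZ.adjoints_sym[OF C]] eq[symmetric]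
        adjoints_hinner[OF XY.adjoints_sym[OF b]] adjoints_hinner[OF F]
        adjoints_hinner[OF XZ.adjoints_sym[OF C], symmetric])
qed

theorem proposition5p4:
  fixes H :: "('x::complex_normed_vector, 'a::cstar_algebra) hmodule"
    and K :: "('y::complex_normed_vector, 'a) hmodule"
    and M :: "'x set" and N :: "'y set" and T :: "'x \<Rightarrow> 'y"
  assumes "hilbert_module H" and "hilbert_module K"
    and "orth_complemented H M" and "orth_complemented K N"
    and "T \<in> adjointable H K"
    and "weakly_complementable H K M N T"
  shows "T ` carrier H \<inter> N \<subseteq> bilateral_shorted H K M N T ` carrier H \<and>
    bilateral_shorted H K M N T ` carrier H \<subseteq> closure (T ` carrier H) \<inter> N"
proof -
  interpret H: complemented H M
    using assms by (simp add: complemented_def complemented_axioms_def)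
  interpret K: complemented K N
    using assms by (simp add: complemented_def complemented_axioms_def)
  interpret HK: hilbert_pair H K by unfold_locales
  define HM HM' KN KN' where "HM = sub H M" and "HM' = sub H (ortho H M)"
    and "KN = sub K N" and "KN' = sub K (ortho K N)"
  note defs = HM_def HM'_def KN_def KN'_def
  have carr [simp]: "carrier HM = M" "carrier HM' = ortho H M" "carrier KN = N" "carrier KN' = ortho K N"
    by (simp_all add: defs)
  have mod: "hilbert_module HM'" "hilbert_module KN" "hilbert_module KN'"
    unfolding defs
    by (intro H.hilbert_module_sub K.hilbert_module_sub H.ortho_closed K.M_closed K.ortho_closed)+
  interpret P22: hilbert_pair HM' KN' using mod by (simp add: hilbert_pair_def)
  interpret P22': hilbert_pair KN' HM' using mod by (simp add: hilbert_pair_def)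
  interpret P12: hilbert_pair HM' KN using mod by (simp add: hilbert_pair_def)
  interpret PF: hilbert_pair KN HM' using mod by (simp add: hilbert_pair_def)
  interpret PF2: hilbert_pair KN KN' using mod by (simp add: hilbert_pair_def)
  interpret PK: hilbert_pair KN K using mod assms by (simp add: hilbert_pair_def)
  interpret PK': hilbert_pair KN' K using mod assms by (simp add: hilbert_pair_def)

  obtain S where T: "adjoints H K T S"
    using HK.adjoints_adj[OF assms(5)] by blast
  note Tc = adjoints_carrier[OF T]
  let ?T11 = "block11 H K M N T" and ?T12 = "block12 H K M N T"
    and ?T21 = "block21 H K M N T" and ?T22 = "block22 H K M N T"
  note iM' = H.adjoints_inclusion_coproj[folded defs]
    and iN = PK.adjoints_sym[OF K.adjoints_inclusion_proj[folded defs]]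
    and iN' = PK'.adjoints_sym[OF K.adjoints_inclusion_coproj[folded defs]]
  have "adjoints HM' KN ?T12 (\<lambda>y. coproj H M (S y))"
    by (rule adjoints_cong[OF adjoints_compose[OF iM' adjoints_compose[OF T iN]]])
      (simp_all add: block12_def H.coproj_ortho)
  then have T12: "?T12 \<in> adjointable HM' KN"
    by (rule P12.adjointableI) (simp add: block12_def)
  have "adjoints HM' KN' ?T22 (\<lambda>y. coproj H M (S y))"
    by (rule adjoints_cong[OF adjoints_compose[OF iM' adjoints_compose[OF T iN']]])
      (simp_all add: block22_def H.coproj_ortho)
  then have T22: "?T22 \<in> adjointable HM' KN'"
    by (rule P22.adjointableI) (simp add: block22_def)
  define A V b B where "A = ?T22" and "V = V_op HM' KN' A" and "b = sqrt_abs HM' KN' A"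
    and "B = sqrt_abs KN' HM' (adj HM' KN' A)"
  interpret D: polar_data HM' KN' A "adj HM' KN' A" V "adj HM' KN' V" "abs_op HM' KN' A" b
    "abs_op KN' HM' (adj HM' KN' A)" B
    using P22.polar_data[OF T22] by (simp add: A_def V_def b_def B_def)
  have Vad: "V \<in> adjointable HM' KN'"
    unfolding V_def by (rule P22.V_op(1)) (simp add: A_def T22)
  note Va = P22.adjoints_adj[OF Vad]
  have V'ad: "adj HM' KN' V \<in> adjointable KN' HM'"
    by (rule P22'.adjointableI[OF P22.adjoints_sym[OF Va(1)] Va(3)])
  have adjV': "adj KN' HM' (adj HM' KN' V) = V"
    by (rule P22'.adj_eq) (simp add: is_adjoint_iff Va(2,3)[simplified] P22.adjoints_sym[OF Va(1)])
  have be: "b \<in> extensional (carrier HM')" and Be: "B \<in> extensional (carrier KN')"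
  proof -
    show "b \<in> extensional (carrier HM')"
      unfolding b_def A_def by (rule P22.sqrt_abs(2)[OF T22])
    have "adj HM' KN' A \<in> adjointable KN' HM'"
      using P22'.adjointableI[OF P22.adjoints_sym[OF D.A]] P22.adjoints_adj(3)[OF T22] by (simp add: A_def)
    then show "B \<in> extensional (carrier KN')"
      unfolding B_def by (rule P22'.sqrt_abs(2))
  qed
  have bad: "b \<in> adjointable HM' HM'" and Bad: "B \<in> adjointable KN' KN'"
    using P22.H.self.adjointableI[OF D.selfadj(2) be] P22.K.self.adjointableI[OF D.selfadj(4) Be] .
  have adjb: "adj HM' HM' b = b" and adjB: "adj KN' KN' B = B"
    using P22.H.self.adj_eq[of b b] P22.K.self.adj_eq[of B B] be Be D.selfadj
    by (simp_all add: is_adjoint_iff)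
  let ?T12' = "adj HM' KN ?T12"
  define E F E2 F2 where "E = the_reduced_solution HM HM' KN' V ?T21"
    and "F = the_reduced_solution KN HM' HM' b ?T12'"
    and "E2 = the_reduced_solution HM KN' KN' B ?T21"
    and "F2 = the_reduced_solution KN KN' HM' (adj HM' KN' V) ?T12'"
  have wc: "has_reduced_solution HM HM' KN' V ?T21" "has_reduced_solution KN HM' HM' b ?T12'"
    "has_reduced_solution HM KN' KN' B ?T21" "has_reduced_solution KN KN' HM' (adj HM' KN' V) ?T12'"
    using assms(6) unfolding weakly_complementable_def Let_def defs[symmetric] A_def[symmetric]
      V_def[symmetric] b_def[symmetric] B_def[symmetric] by blast+
  have E: "reduced_solution HM HM' KN' V ?T21 E"
    unfolding E_def by (rule P22.the_reduced_solution[OF Vad wc(1)])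
  have F: "reduced_solution KN HM' HM' b ?T12' F"
    unfolding F_def by (rule P22.H.self.the_reduced_solution[OF bad wc(2)])
  have E2: "reduced_solution HM KN' KN' B ?T21 E2"
    unfolding E2_def by (rule P22.K.self.the_reduced_solution[OF Bad wc(3)])
  have F2: "reduced_solution KN KN' HM' (adj HM' KN' V) ?T12' F2"
    unfolding F2_def by (rule P22'.the_reduced_solution[OF V'ad wc(4)])
  have VE: "V (E m) = ?T21 m" "E m \<in> closure (adj HM' KN' V ` carrier KN')" "E m \<in> ortho H M"
    if "m \<in> M" for m
    using E that compose_eq[of m M V E] unfolding reduced_solution_def adjointable_def is_adjoint_def
    by auto
  have BE2: "B (E2 m) = ?T21 m" "E2 m \<in> closure (B ` carrier KN')" "E2 m \<in> ortho K N"
    if "m \<in> M" for m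
    using E2 that compose_eq[of m M B E2] unfolding reduced_solution_def adjointable_def is_adjoint_def adjB
    by auto
  have Fad: "F \<in> adjointable KN HM'" and F2ad: "F2 \<in> adjointable KN KN'"
    using F F2 by (auto simp: reduced_solution_def)
  note Fa = PF.adjoints_adj(1)[OF Fad] and F2a = PF2.adjoints_adj(1)[OF F2ad]
  note T12a = P12.adjoints_adj(1)[OF T12]
  have bF: "b (F n) = ?T12' n" and VF2: "adj HM' KN' V (F2 n) = ?T12' n" if "n \<in> carrier KN" for n
    using F F2 that compose_eq[of n N b F] compose_eq[of n N "adj HM' KN' V" F2]
    by (auto simp: reduced_solution_def)
  have T12b: "?T12 w = adj KN HM' F (b w)" if "w \<in> ortho H M" for w
    using that factor_adjoints[OF mod(1,1,2) T12a D.selfadj(2) Fa bF] by simp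
  have T12V: "?T12 w = adj KN KN' F2 (V w)" if "w \<in> ortho H M" for w
    using that factor_adjoints[OF mod(1,3,2) T12a Va(1) F2a VF2] by simp
  define c where "c m = ?T11 m - (1/2) *\<^sub>R (adj KN HM' F (E m) + adj KN KN' F2 (E2 m))" for m
  have corner: "shorted_corner H K M N T m = c m" if "m \<in> M" for m
    using that unfolding shorted_corner_def Let_def defs[symmetric] A_def[symmetric]
      V_def[symmetric] b_def[symmetric] B_def[symmetric] E_def[symmetric] F_def[symmetric]
      E2_def[symmetric] F2_def[symmetric] c_def by simp
  have in_N: "?T11 m \<in> N" "adj KN HM' F (E m) \<in> N" "adj KN KN' F2 (E2 m) \<in> N" if "m \<in> M" for m
    using that adjoints_carrier(2)[OF Fa] adjoints_carrier(2)[OF F2a] VE(3) BE2(3)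
    by (simp_all add: block11_def K.proj_in Tc H.proj_M H.M_carrier)
  have c_N: "c m \<in> N" if "m \<in> M" for m
    using in_N[OF that] P12.K.closed by (simp add: c_def)
  have shorted: "bilateral_shorted H K M N T h = c (proj H M h)" if h: "h \<in> carrier H" for h
    using h K.adj_U_op[OF c_N[OF H.proj_in[OF h]]]
    by (simp add: bilateral_shorted_def U_op_def[of H] corner H.proj_in)
  have decomp: "T (m + w) = (?T11 m + ?T12 w) + (?T21 m + A w)"
    if m: "m \<in> M" and w: "w \<in> ortho H M" for m w
  proof -
    have "T (m + w) = T m + T w"
      using m w by (simp add: HK.adjoints_add[OF T] H.M_carrier H.ortho_carrier)
    also have "\<dots> = (proj K N (T m) + coproj K N (T m)) + (proj K N (T w) + coproj K N (T w))"
      using m w by (simp add: K.proj_add_coproj Tc H.M_carrier H.ortho_carrier)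
    finally show ?thesis
      using m w by (simp add: A_def block11_def block12_def block21_def block22_def H.proj_M H.coproj_ortho)
  qed
  have blocks_in: "?T12 w \<in> N" "A w \<in> ortho K N" if "w \<in> ortho H M" for w
    using that by (simp_all add: A_def block12_def block22_def K.proj_in K.coproj_in Tc H.coproj_ortho
        H.ortho_carrier)
  have T21_in: "?T21 m \<in> ortho K N" if "m \<in> M" for m
    using that by (simp add: block21_def K.coproj_in Tc H.proj_M H.M_carrier)

  have "y \<in> bilateral_shorted H K M N T ` carrier H" if y: "y \<in> T ` carrier H" "y \<in> N" for y
  proof -
    obtain h where h: "h \<in> carrier H" "y = T h" using y by blast
    define m w where "m = proj H M h" and "w = coproj H M h"
    have mw: "m \<in> M" "w \<in> ortho H M" "h = m + w"
      using h by (simp_all add: m_def w_def H.proj_in H.coproj_in H.proj_add_coproj)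
    have y_eq: "y = (?T11 m + ?T12 w) + (?T21 m + A w)"
      using decomp mw h by simp
    \<comment> \<open>The difference lies in \<open>N\<close> and also equals
      \<open>T21 m + A w\<close>, which is in the complement.\<close>
    have "y - (?T11 m + ?T12 w) \<in> N"
      using y in_N[OF mw(1)] blocks_in[OF mw(2)] P12.K.closed by simp
    moreover have "y - (?T11 m + ?T12 w) \<in> ortho K N"
      using T21_in[OF mw(1)] blocks_in[OF mw(2)] P22.K.closed by (simp add: y_eq)
    ultimately have "y - (?T11 m + ?T12 w) = 0" by (rule K.M_inter_ortho)
    then have y11: "y = ?T11 m + ?T12 w" and "?T21 m + A w = 0"
      using y_eq by simp_all
    then have T21: "?T21 m = - A w" by (simp add: eq_neg_iff_add_eq_0)
    have "E m = - b w" and "E2 m = - V w"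
      using D.solution_V[of "E m" w] D.solution_B[of "E2 m" w] VE[OF mw(1)] BE2[OF mw(1)] mw T21
      by simp_all
    moreover have "b w \<in> carrier HM'" "V w \<in> carrier KN'"
      using mw D.carrs by simp_all
    ultimately have "adj KN HM' F (E m) = - ?T12 w" "adj KN KN' F2 (E2 m) = - ?T12 w"
      using mw by (simp_all add: T12b[symmetric] T12V[symmetric] del: carr
          add: hilbert_pair.adjoints_minus[OF PF.hilbert_pair_swap PF.adjoints_sym[OF Fa]]
            hilbert_pair.adjoints_minus[OF PF2.hilbert_pair_swap PF2.adjoints_sym[OF F2a]])
    then have "c m = ?T11 m + (1/2) *\<^sub>R (?T12 w + ?T12 w)"
      by (simp add: c_def scaleR_diff_right scaleR_right_distrib)
    then have "c m = y" by (simp only: scaleR_half_double y11)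
    then have "bilateral_shorted H K M N T m = y"
      using shorted[of m] mw by (simp add: H.M_carrier H.proj_M)
    then show ?thesis using mw H.M_carrier by blast
  qed
  moreover have "bilateral_shorted H K M N T h \<in> closure (T ` carrier H) \<inter> N"
    if h: "h \<in> carrier H" for h
  proof -
    define m where "m = proj H M h"
    have m: "m \<in> M" using h by (simp add: m_def H.proj_in)
    obtain w where w: "\<And>n. w n \<in> carrier HM'" "(\<lambda>n. b (w n)) \<longlonglongrightarrow> E m" "(\<lambda>n. A (w n)) \<longlonglongrightarrow> V (E m)"
      using D.approx_b[OF VE(2)[OF m]] by blast
    obtain v where v: "\<And>n. v n \<in> carrier HM'" "(\<lambda>n. V (v n)) \<longlonglongrightarrow> E2 m" "(\<lambda>n. A (v n)) \<longlonglongrightarrow> B (E2 m)"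
      using D.approx_V[OF BE2(2)[OF m]] by blast
    have "(\<lambda>n. adj KN HM' F (b (w n))) \<longlonglongrightarrow> adj KN HM' F (E m)"
      using w D.carrs VE(3)[OF m]
      by (intro hilbert_pair.adjoints_tendsto[OF PF.hilbert_pair_swap PF.adjoints_sym[OF Fa]]) auto
    then have w12: "(\<lambda>n. ?T12 (w n)) \<longlonglongrightarrow> adj KN HM' F (E m)"
      using w(1) by (simp add: T12b)
    have "(\<lambda>n. adj KN KN' F2 (V (v n))) \<longlonglongrightarrow> adj KN KN' F2 (E2 m)"
      using v D.carrs BE2(3)[OF m]
      by (intro hilbert_pair.adjoints_tendsto[OF PF2.hilbert_pair_swap PF2.adjoints_sym[OF F2a]]) auto
    then have v12: "(\<lambda>n. ?T12 (v n)) \<longlonglongrightarrow> adj KN KN' F2 (E2 m)"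
      using v(1) by (simp add: T12V)
    \<comment> \<open>The average matches the factor 1/2 in the corner, since \<open>T12\<close>
      sends the two sequences to approximants of \<open>F* E m\<close> and
      \<open>F2* E2 m\<close>.\<close>
    let ?u = "\<lambda>n. (1/2) *\<^sub>R (w n + v n)"
    have u: "- ?u n \<in> ortho H M" for n
      using w(1) v(1) P22.H.closed by simp
    have T12u: "?T12 (- ?u n) = - ((1/2) *\<^sub>R (?T12 (w n) + ?T12 (v n)))" for n
      using w(1) v(1) P22.H.closed
      by (simp add: P12.adjoints_linear[OF T12a])
    have Au: "A (- ?u n) = - ((1/2) *\<^sub>R (A (w n) + A (v n)))" for n
      using w(1) v(1) P22.H.closed
      by (simp add: P22.adjoints_linear[OF D.A])
    have "(\<lambda>n. (?T11 m + - ((1/2) *\<^sub>R (?T12 (w n) + ?T12 (v n))))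
        + (?T21 m + - ((1/2) *\<^sub>R (A (w n) + A (v n)))))
      \<longlonglongrightarrow> (?T11 m + - ((1/2) *\<^sub>R (adj KN HM' F (E m) + adj KN KN' F2 (E2 m))))
        + (?T21 m + - ((1/2) *\<^sub>R (V (E m) + B (E2 m))))"
      by (intro tendsto_intros w12 v12 w v)
    also have "(\<lambda>n. (?T11 m + - ((1/2) *\<^sub>R (?T12 (w n) + ?T12 (v n))))
        + (?T21 m + - ((1/2) *\<^sub>R (A (w n) + A (v n))))) = (\<lambda>n. T (m + - ?u n))"
      by (simp only: decomp[OF m u] T12u Au)
    also have "(?T11 m + - ((1/2) *\<^sub>R (adj KN HM' F (E m) + adj KN KN' F2 (E2 m))))
        + (?T21 m + - ((1/2) *\<^sub>R (V (E m) + B (E2 m)))) = c m"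
      \<comment> \<open>\<open>V (E m)\<close> and \<open>B (E2 m)\<close> both equal
        \<open>T21 m\<close>, so the component in the complement of \<open>N\<close>
        cancels.\<close>
      by (simp only: VE(1)[OF m] BE2(1)[OF m] scaleR_half_double) (simp add: c_def)
    finally have "(\<lambda>n. T (m + - ?u n)) \<longlonglongrightarrow> c m" .
    moreover have "T (m + - ?u n) \<in> T ` carrier H" for n
      using m u H.M_carrier H.ortho_carrier by (intro imageI H.add_closed) auto
    ultimately have "c m \<in> closure (T ` carrier H)"
      unfolding closure_sequential by (intro exI[of _ "\<lambda>n. T (m + - ?u n)"]) simp
    then show ?thesis using shorted[OF h] c_N[OF m] by (simp add: m_def)
  qed
  ultimately show ?thesis by blast
qed

end
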